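(* Consider the system $$\Delta_1:=u_t+(u^2-v)_x=0,\qquad \Delta_2:=v_t+\left(\tfrac13u^3-u\right)_x=0$$ for unknowns $u,v$ depending on $(x,t)$. The one-parameter transformation groups acting on $(x,t,u,v)\in\mathbb R^4$, with group parameter $\eta\in\mathbb R$, $$G_1:(x,t,u,v)\mapsto(e^\eta x,e^\eta t,u,v),\qquad G_2:(x,t,u,v)\mapsto(x,t+\eta,u,v),$$ $$G_3:(x,t,u,v)\mapsto\left(x+\eta t,\,t,\,u+\eta,\,v+\eta u+\tfrac{\eta^2}{2}\right),$$ $$G_4:(x,t,u,v)\mapsto(x+\eta,t,u,v),\qquad G_5:(x,t,u,v)\mapsto(x,t,u,v+\eta),$$ which are symmetry groups of the system, are $\mathcal{AS}^1_\Delta$-symmetry groups of the system; that is, they transform $1$-strongly associated solutions of the system into $1$-strongly associated solutions.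
   Context: Colombeau algebra: for $\Omega\subseteq\mathbb R^2$ open, $\mathcal G(\Omega)=\mathcal E_M(\Omega)/\mathcal N(\Omega)$, where $\mathcal E_M(\Omega)$ is the set of nets $(u_\varepsilon)_{\varepsilon\in(0,1]}$ in $C^\infty(\Omega)$ such that on each compact set every derivative is $O(\varepsilon^{-N})$ for some $N$, and $\mathcal N(\Omega)$ the subset of nets such that on each compact set every derivative is $O(\varepsilon^m)$ for all $m$. $1$-strongly associated solution on $\Omega$: a pair $(u,v)\in\mathcal G(\Omega)^2$ having representatives $(u_\varepsilon),(v_\varepsilon)\in\mathcal E_M(\Omega)$ such that for every $B\subseteq C_c^\infty(\Omega)$ bounded in $C_c^1(\Omega)$ (all $\varphi\in B$ supported in a common compact subset of $\Omega$, with $\varphi$ and its first derivatives bounded uniformly over $B$), $$\lim_{\varepsilon\to0}\sup_{\varphi\in B}\left|\int_\Omega\Delta_\nu[u_\varepsilon,v_\varepsilon]\,\varphi\,dx\,dt\right|=0,\quad\nu=1,2,$$ where $\Delta_\nu[u_\varepsilon,v_\varepsilon]$ is $\Delta_\nu$ evaluated at $(u_\varepsilon,v_\varepsilon)$. The set of these is $\mathcal{AS}^1_\Delta$. Action on functions: a transformation $g_\eta:(x,t,u,v)\mapsto(\Xi_\eta(x,t),\Phi_\eta(x,t,u,v))$ is called projectable; it acts on $f=(u,v)$ defined on $\Omega$ by $g_\eta f=\big(\Phi_\eta\circ(\mathrm{id}\times f)\big)\circ\Xi_\eta^{-1}$, defined on $\Xi_\eta(\Omega)$ (applied to generalized functions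 via representatives). A symmetry group of the system is an $\mathcal{AS}^1_\Delta$-symmetry group if $g_\eta f$ is a $1$-strongly associated solution whenever $f$ is one and $g_\eta f$ is defined. *)

theory Defs
  imports "HOL-Analysis.Analysis"
begin

section \<open>Smooth functions\<close>

definition pderiv_dir :: "'a::euclidean_space \<Rightarrow> ('a \<Rightarrow> 'b::real_normed_vector) \<Rightarrow> 'a \<Rightarrow> 'b" where
  "pderiv_dir b f z = vector_derivative (\<lambda>s. f (z + s *\<^sub>R b)) (at 0)"

definition iter_pderiv :: "'a::euclidean_space list \<Rightarrow> ('a \<Rightarrow> 'b::real_normed_vector) \<Rightarrow> 'a \<Rightarrow> 'b" where
  "iter_pderiv bs f = foldr pderiv_dir bs f"

text \<open>Only used for open \<open>S\<close>. Since each iterated partial derivative is required to be (totally)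
  differentiable, the next partial derivatives exist and all of them are continuous, so this is
  \<open>C\<^sup>\<infinity>\<close>. The values of \<open>f\<close> outside \<open>S\<close> do not matter.\<close>

definition smooth_on :: "'a::euclidean_space set \<Rightarrow> ('a \<Rightarrow> 'b::real_normed_vector) \<Rightarrow> bool" where
  "smooth_on S f \<longleftrightarrow> (\<forall>bs. set bs \<subseteq> Basis \<longrightarrow> iter_pderiv bs f differentiable_on S)"

abbreviation dx :: "(real \<times> real \<Rightarrow> real) \<Rightarrow> real \<times> real \<Rightarrow> real" where
  "dx \<equiv> pderiv_dir (1, 0)"

abbreviation dt :: "(real \<times> real \<Rightarrow> real) \<Rightarrow> real \<times> real \<Rightarrow> real" where
  "dt \<equiv> pderiv_dir (0, 1)"


section \<open>The Colombeau algebra on an open subset of the plane\<close>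

text \<open>A net is a function of \<open>\<epsilon>\<close>; only the parameters \<open>0 < \<epsilon> \<le> 1\<close> and the values on \<open>\<Omega>\<close> are
  constrained. Nets that differ elsewhere only are identified in the quotient.\<close>

type_synonym net = "real \<Rightarrow> real \<times> real \<Rightarrow> real"

definition moderate_nets :: "(real \<times> real) set \<Rightarrow> net set" where
  "moderate_nets \<Omega> = {u.
     (\<forall>\<epsilon>\<in>{0<..1}. smooth_on \<Omega> (u \<epsilon>)) \<and>
     (\<forall>K bs. compact K \<and> K \<subseteq> \<Omega> \<and> set bs \<subseteq> Basis \<longrightarrow>
        (\<exists>(N::nat) C. \<forall>\<^sub>F \<epsilon> in at_right 0. \<forall>z\<in>K. \<bar>iter_pderiv bs (u \<epsilon>) z\<bar> \<le> C / \<epsilon> ^ N))}"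

definition negligible_nets :: "(real \<times> real) set \<Rightarrow> net set" where
  "negligible_nets \<Omega> = {u \<in> moderate_nets \<Omega>.
     \<forall>K bs. compact K \<and> K \<subseteq> \<Omega> \<and> set bs \<subseteq> Basis \<longrightarrow>
        (\<forall>m::nat. \<exists>C. \<forall>\<^sub>F \<epsilon> in at_right 0. \<forall>z\<in>K. \<bar>iter_pderiv bs (u \<epsilon>) z\<bar> \<le> C * \<epsilon> ^ m)}"

definition colombeau_rel :: "(real \<times> real) set \<Rightarrow> net rel" where
  "colombeau_rel \<Omega> = {(u, v). u \<in> moderate_nets \<Omega> \<and> v \<in> moderate_nets \<Omega> \<and>
     (\<lambda>\<epsilon> z. u \<epsilon> z - v \<epsilon> z) \<in> negligible_nets \<Omega>}"

definition colombeau :: "(real \<times> real) set \<Rightarrow> net set set" where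
  "colombeau \<Omega> = moderate_nets \<Omega> // colombeau_rel \<Omega>"


section \<open>The system and its solutions\<close>

definition Delta1 :: "(real \<times> real \<Rightarrow> real) \<Rightarrow> (real \<times> real \<Rightarrow> real) \<Rightarrow> real \<times> real \<Rightarrow> real" where
  "Delta1 u v z = dt u z + dx (\<lambda>y. (u y)\<^sup>2 - v y) z"

definition Delta2 :: "(real \<times> real \<Rightarrow> real) \<Rightarrow> (real \<times> real \<Rightarrow> real) \<Rightarrow> real \<times> real \<Rightarrow> real" where
  "Delta2 u v z = dt v z + dx (\<lambda>y. 1 / 3 * (u y) ^ 3 - u y) z"

definition classical_solution :: "(real \<times> real) set \<Rightarrow> (real \<times> real \<Rightarrow> real \<times> real) \<Rightarrow> bool" where
  "classical_solution \<Omega> f \<longleftrightarrow> open \<Omega> \<and> smooth_on \<Omega> f \<and>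
     (\<forall>z\<in>\<Omega>. Delta1 (fst \<circ> f) (snd \<circ> f) z = 0 \<and> Delta2 (fst \<circ> f) (snd \<circ> f) z = 0)"

text \<open>Test functions on \<open>\<Omega>\<close> are extended by zero to the whole plane.\<close>

definition test_functions :: "(real \<times> real) set \<Rightarrow> (real \<times> real \<Rightarrow> real) set" where
  "test_functions \<Omega> = {\<phi>. smooth_on UNIV \<phi> \<and>
     compact (closure {z. \<phi> z \<noteq> 0}) \<and> closure {z. \<phi> z \<noteq> 0} \<subseteq> \<Omega>}"

definition bounded_in_Cc1 :: "(real \<times> real) set \<Rightarrow> (real \<times> real \<Rightarrow> real) set \<Rightarrow> bool" where
  "bounded_in_Cc1 \<Omega> B \<longleftrightarrow>
     (\<exists>K. compact K \<and> K \<subseteq> \<Omega> \<and> (\<forall>\<phi>\<in>B. closure {z. \<phi> z \<noteq> 0} \<subseteq> K)) \<and>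
     (\<exists>C. \<forall>\<phi>\<in>B. \<forall>z. \<bar>\<phi> z\<bar> \<le> C \<and> \<bar>dx \<phi> z\<bar> \<le> C \<and> \<bar>dt \<phi> z\<bar> \<le> C)"

text \<open>The supremum is taken in \<^typ>\<open>ennreal\<close>, so that it is meaningful (and \<open>0\<close>) for empty \<open>B\<close>.\<close>

definition AS1_solution :: "(real \<times> real) set \<Rightarrow> net set \<times> net set \<Rightarrow> bool" where
  "AS1_solution \<Omega> F \<longleftrightarrow> open \<Omega> \<and> F \<in> colombeau \<Omega> \<times> colombeau \<Omega> \<and>
     (\<exists>u\<in>fst F. \<exists>v\<in>snd F. \<forall>B. B \<subseteq> test_functions \<Omega> \<and> bounded_in_Cc1 \<Omega> B \<longrightarrow>
        (\<forall>\<Delta>\<in>{Delta1, Delta2}.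
          ((\<lambda>\<epsilon>. SUP \<phi>\<in>B. ennreal \<bar>LINT z:\<Omega>|lborel. \<Delta> (u \<epsilon>) (v \<epsilon>) z * \<phi> z\<bar>) \<longlongrightarrow> 0) (at_right 0)))"


section \<open>Projectable transformations and symmetry groups\<close>

text \<open>A point of \<open>\<real>\<^sup>4\<close> is written \<open>((x, t), (u, v))\<close>.\<close>

type_synonym transf = "(real \<times> real) \<times> (real \<times> real) \<Rightarrow> (real \<times> real) \<times> (real \<times> real)"

text \<open>\<open>base_map g\<close> is \<open>\<Xi>\<close> and \<open>fibre_map g\<close> is \<open>\<Phi>\<close> when \<open>g\<close> is projectable; the fibre coordinates
  \<open>(0, 0)\<close> in \<open>base_map\<close> are then irrelevant.\<close>

definition base_map :: "transf \<Rightarrow> real \<times> real \<Rightarrow> real \<times> real" where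
  "base_map g z = fst (g (z, (0, 0)))"

definition fibre_map :: "transf \<Rightarrow> (real \<times> real) \<times> (real \<times> real) \<Rightarrow> real \<times> real" where
  "fibre_map g p = snd (g p)"

definition projectable :: "transf \<Rightarrow> bool" where
  "projectable g \<longleftrightarrow> (\<forall>z w. fst (g (z, w)) = base_map g z)"

text \<open>\<open>g f = (\<Phi> \<circ> (id \<times> f)) \<circ> \<Xi>\<inverse>\<close> for \<open>f\<close> defined on \<open>\<Omega>\<close>; meaningful on \<open>\<Xi>(\<Omega>)\<close>.\<close>

definition act_fun :: "transf \<Rightarrow> (real \<times> real) set \<Rightarrow> (real \<times> real \<Rightarrow> real \<times> real) \<Rightarrow> real \<times> real \<Rightarrow> real \<times> real" where
  "act_fun g \<Omega> f = (\<lambda>z. fibre_map g (z, f z)) \<circ> inv_into \<Omega> (base_map g)"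

definition act_net1 :: "transf \<Rightarrow> (real \<times> real) set \<Rightarrow> net \<Rightarrow> net \<Rightarrow> net" where
  "act_net1 g \<Omega> u v = (\<lambda>\<epsilon>. fst \<circ> act_fun g \<Omega> (\<lambda>z. (u \<epsilon> z, v \<epsilon> z)))"

definition act_net2 :: "transf \<Rightarrow> (real \<times> real) set \<Rightarrow> net \<Rightarrow> net \<Rightarrow> net" where
  "act_net2 g \<Omega> u v = (\<lambda>\<epsilon>. snd \<circ> act_fun g \<Omega> (\<lambda>z. (u \<epsilon> z, v \<epsilon> z)))"

text \<open>The action on a pair of generalized functions is defined if \<open>\<Xi>\<close> is invertible on \<open>\<Omega>\<close> and the
  action on representatives yields moderate nets (part of \<^const>\<open>colombeau_rel\<close>) whose classes do
  not depend on the representatives. In that case the unions in \<open>act_gen\<close> are unions of one and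
  the same class.\<close>

definition act_gen_defined :: "transf \<Rightarrow> (real \<times> real) set \<Rightarrow> net set \<times> net set \<Rightarrow> bool" where
  "act_gen_defined g \<Omega> F \<longleftrightarrow> inj_on (base_map g) \<Omega> \<and>
     (\<forall>u\<in>fst F. \<forall>u'\<in>fst F. \<forall>v\<in>snd F. \<forall>v'\<in>snd F.
        (act_net1 g \<Omega> u v, act_net1 g \<Omega> u' v') \<in> colombeau_rel (base_map g ` \<Omega>) \<and>
        (act_net2 g \<Omega> u v, act_net2 g \<Omega> u' v') \<in> colombeau_rel (base_map g ` \<Omega>))"

definition act_gen :: "transf \<Rightarrow> (real \<times> real) set \<Rightarrow> net set \<times> net set \<Rightarrow> net set \<times> net set" where
  "act_gen g \<Omega> F =
     (\<Union>u\<in>fst F. \<Union>v\<in>snd F. colombeau_rel (base_map g ` \<Omega>) `` {act_net1 g \<Omega> u v},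
      \<Union>u\<in>fst F. \<Union>v\<in>snd F. colombeau_rel (base_map g ` \<Omega>) `` {act_net2 g \<Omega> u v})"

definition one_parameter_group :: "(real \<Rightarrow> transf) \<Rightarrow> bool" where
  "one_parameter_group G \<longleftrightarrow> smooth_on UNIV (\<lambda>(\<eta>, p). G \<eta> p) \<and>
     G 0 = id \<and> (\<forall>\<eta> \<theta>. G (\<eta> + \<theta>) = G \<eta> \<circ> G \<theta>)"

definition symmetry_group :: "(real \<Rightarrow> transf) \<Rightarrow> bool" where
  "symmetry_group G \<longleftrightarrow> one_parameter_group G \<and> (\<forall>\<eta>. projectable (G \<eta>)) \<and>
     (\<forall>\<eta> \<Omega> f. classical_solution \<Omega> f \<and> inj_on (base_map (G \<eta>)) \<Omega> \<longrightarrow>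
        classical_solution (base_map (G \<eta>) ` \<Omega>) (act_fun (G \<eta>) \<Omega> f))"

definition AS1_symmetry_group :: "(real \<Rightarrow> transf) \<Rightarrow> bool" where
  "AS1_symmetry_group G \<longleftrightarrow> symmetry_group G \<and>
     (\<forall>\<eta> \<Omega> F. AS1_solution \<Omega> F \<and> act_gen_defined (G \<eta>) \<Omega> F \<longrightarrow>
        AS1_solution (base_map (G \<eta>) ` \<Omega>) (act_gen (G \<eta>) \<Omega> F))"

definition G1 :: "real \<Rightarrow> transf" where
  "G1 \<eta> = (\<lambda>((x, t), (u, v)). ((exp \<eta> * x, exp \<eta> * t), (u, v)))"

definition G2 :: "real \<Rightarrow> transf" where
  "G2 \<eta> = (\<lambda>((x, t), (u, v)). ((x, t + \<eta>), (u, v)))"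

definition G3 :: "real \<Rightarrow> transf" where
  "G3 \<eta> = (\<lambda>((x, t), (u, v)). ((x + \<eta> * t, t), (u + \<eta>, v + \<eta> * u + \<eta>\<^sup>2 / 2)))"

definition G4 :: "real \<Rightarrow> transf" where
  "G4 \<eta> = (\<lambda>((x, t), (u, v)). ((x + \<eta>, t), (u, v)))"

definition G5 :: "real \<Rightarrow> transf" where
  "G5 \<eta> = (\<lambda>((x, t), (u, v)). ((x, t), (u, v + \<eta>)))"

end

theory Submission
  imports Defs
begin

text \<open>All five groups lie in the family
  \<open>(x, t, u, v) \<mapsto> (s (x + k t) + p, s t + q, u + k, v + k u + d)\<close> with \<open>s \<noteq> 0\<close>. If \<open>(U, V)\<close> is
  the image of \<open>(u, v)\<close>, then at corresponding points \<open>s \<Delta>\<^sub>1[U, V] = \<Delta>\<^sub>1[u, v]\<close> and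
  \<open>s \<Delta>\<^sub>2[U, V] = \<Delta>\<^sub>2[u, v] + k \<Delta>\<^sub>1[u, v]\<close>: the system is mapped to an invertible constant-coefficient
  linear combination of itself. Since the change of the independent variables is affine, it has
  constant Jacobian \<open>s\<^sup>2\<close> and maps \<open>C\<^sub>c\<^sup>1\<close>-bounded sets of test functions to such sets, so the
  integrals against \<open>\<phi>\<close> for \<open>(U, V)\<close> are fixed linear combinations of those against
  \<open>\<phi> \<circ> \<Xi>\<close> for \<open>(u, v)\<close>, and the uniform limits carry over.\<close>

section \<open>Calculus of smooth functions\<close>

text \<open>The form of the fibre map is dictated by the fluxes. A boost with velocity
  \<open>k\<close> turns the time derivative of \<open>u\<close> into one carrying
  \<open>- k * dx u\<close>, while replacing \<open>u\<close> by \<open>u + k\<close> in the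
  quadratic flux yields \<open>2 * k * dx u\<close>. One surplus \<open>k * dx u\<close> remains in
  \<open>Delta1\<close>, and it is removed exactly when \<open>v\<close> gains \<open>k * u\<close>.
  Two separate demands meet in the proof. Growth in \<open>\<epsilon>\<close> has to be controlled
  only for \<open>u\<close>, \<open>v\<close> and their images, never for \<open>Delta1\<close> or
  \<open>Delta2\<close>. As the fibre map is affine in \<open>(u, v)\<close> and the base map is
  affine, linear combinations and composition with an affine map are the only operations on nets
  that occur, and no estimate for products of nets enters. The nonlinearity of the system is met
  only for a single \<open>\<epsilon>\<close>, where it is a matter of classical derivatives. Being
  a solution asks for one suitable pair of representatives. The image of the given pair serves, and
  it lies in the right classes once the action is known to respect the equivalence of nets.\<close>

lemma pderiv_dir_eq:
  assumes "(f has_derivative f') (at z)"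
  shows "pderiv_dir b f z = f' b"
proof -
  have "((\<lambda>s. z + s *\<^sub>R b) has_derivative (\<lambda>s. s *\<^sub>R b)) (at (0::real))"
    by (auto intro!: derivative_eq_intros)
  then have "(f \<circ> (\<lambda>s. z + s *\<^sub>R b) has_derivative f' \<circ> (\<lambda>s. s *\<^sub>R b)) (at (0::real))"
    by (rule diff_chain_at) (use assms in simp)
  moreover have "f' \<circ> (\<lambda>s. s *\<^sub>R b) = (\<lambda>s. s *\<^sub>R f' b)"
    using has_derivative_bounded_linear[OF assms] by (auto simp: linear_simps)
  ultimately show ?thesis
    unfolding pderiv_dir_def
    by (intro vector_derivative_at) (simp add: has_vector_derivative_def o_def)
qed

text \<open>Short steps from \<open>z\<close> stay in the open set, so the derivative is local. This
  matters throughout: the transformed nets are known by a formula only on the image of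
  \<open>\<Omega>\<close>, and elsewhere their values come from an arbitrary choice of
  \<open>inv_into\<close>.\<close>

lemma pderiv_dir_cong:
  assumes "open S" "z \<in> S" "\<And>y. y \<in> S \<Longrightarrow> f y = g y"
  shows "pderiv_dir b f z = pderiv_dir b g z"
proof -
  have "((\<lambda>s::real. z + s *\<^sub>R b) \<longlongrightarrow> z + 0 *\<^sub>R b) (nhds 0)"
    by (intro tendsto_intros) (simp add: filterlim_ident)
  then have "eventually (\<lambda>s::real. z + s *\<^sub>R b \<in> S) (nhds 0)"
    using assms(1,2) by (simp add: tendsto_def)
  then show ?thesis
    unfolding pderiv_dir_def
    by (intro vector_derivative_cong_eq) (auto elim!: eventually_mono simp: assms(3))
qed

lemma iter_pderiv_Nil [simp]: "iter_pderiv [] f = f"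
  by (simp add: iter_pderiv_def)

lemma iter_pderiv_Cons [simp]: "iter_pderiv (b # bs) f = pderiv_dir b (iter_pderiv bs f)"
  by (simp add: iter_pderiv_def)

text \<open>The last entry of the list is the derivative taken first. Peeling it off lets a
  statement about \<open>f\<close> be applied again to its first derivative.\<close>

lemma iter_pderiv_snoc: "iter_pderiv (bs @ [b]) f = iter_pderiv bs (pderiv_dir b f)"
  by (simp add: iter_pderiv_def)

lemma iter_pderiv_cong:
  assumes "open S" "z \<in> S" "\<And>y. y \<in> S \<Longrightarrow> f y = g y"
  shows "iter_pderiv bs f z = iter_pderiv bs g z"
  using \<open>z \<in> S\<close>
proof (induction bs arbitrary: z)
  case (Cons b bs)
  then show ?case by (auto intro: pderiv_dir_cong[OF \<open>open S\<close>])
qed (simp add: assms)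

lemma iter_pderiv_const: "iter_pderiv bs (\<lambda>_. c) = (\<lambda>_. if bs = [] then c else 0)"
proof (induction bs)
  case (Cons b bs)
  have "pderiv_dir b (\<lambda>_. c') = (\<lambda>_. 0)" for c' :: 'b
    by (rule ext, rule pderiv_dir_eq) (rule has_derivative_const)
  with Cons show ?case by simp
qed simp

lemma smooth_on_iter_differentiable:
  assumes "smooth_on S f" "open S" "set bs \<subseteq> Basis" "z \<in> S"
  shows "iter_pderiv bs f differentiable (at z)"
  using assms by (auto simp: smooth_on_def differentiable_on_eq_differentiable_at)

lemma smooth_on_differentiable:
  assumes "smooth_on S f" "open S" "z \<in> S"
  shows "f differentiable (at z)"
  using smooth_on_iter_differentiable[OF assms(1,2), of "[]"] assms(3) by simp

lemma smooth_on_pderiv: "smooth_on S f \<Longrightarrow> b \<in> Basis \<Longrightarrow> smooth_on S (pderiv_dir b f)"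
  unfolding smooth_on_def iter_pderiv_snoc[symmetric] by auto

lemma smooth_on_continuous: "smooth_on S f \<Longrightarrow> continuous_on S f"
  unfolding smooth_on_def
  by (metis differentiable_imp_continuous_on empty_set empty_subsetI iter_pderiv_Nil)

lemma smooth_on_cong:
  assumes "open S" "smooth_on S f" "\<And>z. z \<in> S \<Longrightarrow> f z = g z"
  shows "smooth_on S g"
  unfolding smooth_on_def
proof (intro allI impI)
  fix bs :: "'a list" assume bs: "set bs \<subseteq> Basis"
  have "iter_pderiv bs f differentiable_on S"
    using assms(2) bs by (simp add: smooth_on_def)
  then show "iter_pderiv bs g differentiable_on S"
    using iter_pderiv_cong[OF \<open>open S\<close> _ assms(3)]
    by (auto simp: differentiable_on_def elim!: differentiable_transform_within[OF _ zero_less_one])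
qed

lemma smooth_on_const: "smooth_on S (\<lambda>_. c)"
  by (simp add: smooth_on_def iter_pderiv_const)

text \<open>A bounded linear map commutes with each derivative. The induction needs the equality on
  all of the open set \<open>S\<close>, not at \<open>z\<close> alone, before it can be
  differentiated once more. Projections, constant factors and sums are all obtained as
  instances.\<close>

lemma iter_pderiv_linear:
  assumes "bounded_linear M" "smooth_on S f" "open S" "set bs \<subseteq> Basis" "z \<in> S"
  shows "iter_pderiv bs (\<lambda>z. M (f z)) z = M (iter_pderiv bs f z)"
  using assms(4,5)
proof (induction bs arbitrary: z)
  case (Cons b bs)
  then have "iter_pderiv bs f differentiable (at z)"
    using assms by (intro smooth_on_iter_differentiable) auto
  then obtain f' where f': "(iter_pderiv bs f has_derivative f') (at z)"
    by (auto simp: differentiable_def)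
  have "iter_pderiv (b # bs) (\<lambda>z. M (f z)) z = pderiv_dir b (\<lambda>z. M (iter_pderiv bs f z)) z"
    using Cons by (auto intro!: pderiv_dir_cong[OF \<open>open S\<close>])
  also have "\<dots> = M (f' b)"
    by (intro pderiv_dir_eq bounded_linear.has_derivative[OF assms(1) f'])
  finally show ?case by (simp add: pderiv_dir_eq[OF f'])
qed simp

lemma smooth_on_linear:
  fixes f :: "'a::euclidean_space \<Rightarrow> 'b::real_normed_vector"
  assumes "bounded_linear M" "smooth_on S f" "open S"
  shows "smooth_on S (\<lambda>z. M (f z))"
  unfolding smooth_on_def differentiable_on_eq_differentiable_at[OF \<open>open S\<close>]
proof (intro allI impI ballI)
  fix bs :: "'a list" and z assume bs: "set bs \<subseteq> Basis" and z: "z \<in> S"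
  obtain f' where f': "(iter_pderiv bs f has_derivative f') (at z)"
    using smooth_on_iter_differentiable[OF assms(2,3) bs z] by (auto simp: differentiable_def)
  have "(iter_pderiv bs (\<lambda>z. M (f z)) has_derivative (\<lambda>h. M (f' h))) (at z)"
    by (rule has_derivative_transform_within_open[OF bounded_linear.has_derivative[OF assms(1) f'] \<open>open S\<close> z])
       (simp add: iter_pderiv_linear[OF assms bs])
  then show "iter_pderiv bs (\<lambda>z. M (f z)) differentiable (at z)"
    by (auto simp: differentiable_def)
qed

lemma iter_pderiv_Pair:
  assumes "smooth_on S f" "smooth_on S g" "open S" "set bs \<subseteq> Basis" "z \<in> S"
  shows "iter_pderiv bs (\<lambda>z. (f z, g z)) z = (iter_pderiv bs f z, iter_pderiv bs g z)"
  using assms(4,5)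
proof (induction bs arbitrary: z)
  case (Cons b bs)
  then have "iter_pderiv bs f differentiable (at z)" "iter_pderiv bs g differentiable (at z)"
    using assms by (auto intro!: smooth_on_iter_differentiable)
  then obtain f' g' where d: "(iter_pderiv bs f has_derivative f') (at z)"
    "(iter_pderiv bs g has_derivative g') (at z)"
    by (auto simp: differentiable_def)
  have "iter_pderiv (b # bs) (\<lambda>z. (f z, g z)) z
      = pderiv_dir b (\<lambda>z. (iter_pderiv bs f z, iter_pderiv bs g z)) z"
    using Cons by (auto intro!: pderiv_dir_cong[OF \<open>open S\<close>])
  also have "\<dots> = (f' b, g' b)"
    by (intro pderiv_dir_eq has_derivative_Pair d)
  finally show ?case by (simp add: pderiv_dir_eq[OF d(1)] pderiv_dir_eq[OF d(2)])
qed simp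

lemma smooth_on_Pair:
  fixes f :: "'a::euclidean_space \<Rightarrow> 'b::real_normed_vector"
    and g :: "'a \<Rightarrow> 'c::real_normed_vector"
  assumes "smooth_on S f" "smooth_on S g" "open S"
  shows "smooth_on S (\<lambda>z. (f z, g z))"
  unfolding smooth_on_def differentiable_on_eq_differentiable_at[OF \<open>open S\<close>]
proof (intro allI impI ballI)
  fix bs :: "'a list" and z assume bs: "set bs \<subseteq> Basis" and z: "z \<in> S"
  obtain f' g' where d: "(iter_pderiv bs f has_derivative f') (at z)"
    "(iter_pderiv bs g has_derivative g') (at z)"
    using smooth_on_iter_differentiable[OF assms(1,3) bs z]
      smooth_on_iter_differentiable[OF assms(2,3) bs z]
    by (auto simp: differentiable_def)
  have "(iter_pderiv bs (\<lambda>z. (f z, g z)) has_derivative (\<lambda>h. (f' h, g' h))) (at z)"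
    by (rule has_derivative_transform_within_open[OF has_derivative_Pair[OF d] \<open>open S\<close> z])
       (simp add: iter_pderiv_Pair[OF assms bs])
  then show "iter_pderiv bs (\<lambda>z. (f z, g z)) differentiable (at z)"
    by (auto simp: differentiable_def)
qed

text \<open>Addition is a linear map on pairs, so the rules for sums follow from those for pairs and
  linear maps.\<close>

lemma bounded_linear_add_pair: "bounded_linear (\<lambda>p. fst p + snd p)"
  by (intro bounded_linear_add bounded_linear_fst bounded_linear_snd)

lemma smooth_on_add:
  assumes "smooth_on S f" "smooth_on S g" "open S"
  shows "smooth_on S (\<lambda>z. f z + g z)"
  using smooth_on_linear[OF bounded_linear_add_pair smooth_on_Pair[OF assms] assms(3)] by simp

lemma iter_pderiv_add:
  assumes "smooth_on S f" "smooth_on S g" "open S" "set bs \<subseteq> Basis" "z \<in> S"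
  shows "iter_pderiv bs (\<lambda>z. f z + g z) z = iter_pderiv bs f z + iter_pderiv bs g z"
  using iter_pderiv_linear[OF bounded_linear_add_pair smooth_on_Pair[OF assms(1-3)] assms(3-5)]
    iter_pderiv_Pair[OF assms] by simp

lemma smooth_on_cmult:
  fixes f :: "'a::euclidean_space \<Rightarrow> 'b::real_normed_algebra"
  assumes "smooth_on S f" "open S"
  shows "smooth_on S (\<lambda>z. c * f z)"
  by (rule smooth_on_linear[OF bounded_linear_mult_right assms])

lemma iter_pderiv_cmult:
  fixes f :: "'a::euclidean_space \<Rightarrow> 'b::real_normed_algebra"
  assumes "smooth_on S f" "open S" "set bs \<subseteq> Basis" "z \<in> S"
  shows "iter_pderiv bs (\<lambda>z. c * f z) z = c * iter_pderiv bs f z"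
  by (rule iter_pderiv_linear[OF bounded_linear_mult_right assms])

lemma smooth_on_diff:
  assumes "smooth_on S f" "smooth_on S g" "open S"
  shows "smooth_on S (\<lambda>z. f z - g z)"
  using smooth_on_add[OF assms(1) smooth_on_linear[OF bounded_linear_minus[OF bounded_linear_ident] assms(2,3)] assms(3)]
  by simp

text \<open>A class \<open>P\<close> of differentiable functions that is stable under partial
  derivatives consists of smooth functions. Stability is required only up to equality on
  \<open>S\<close>, since derivatives computed by the calculus rules are known only there. Choosing
  \<open>P\<close> replaces explicit formulas for higher derivatives.\<close>

lemma smooth_on_coinduct:
  assumes S: "open S" and "P f"
    and diff: "\<And>f z. P f \<Longrightarrow> z \<in> S \<Longrightarrow> f differentiable (at z)"
    and step: "\<And>f b. P f \<Longrightarrow> b \<in> Basis \<Longrightarrow> \<exists>g. P g \<and> (\<forall>z\<in>S. pderiv_dir b f z = g z)"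
  shows "smooth_on S f"
proof -
  have "\<exists>g. P g \<and> (\<forall>z\<in>S. iter_pderiv bs f z = g z)" if "set bs \<subseteq> Basis" for bs
    using that
  proof (induction bs)
    case (Cons b bs)
    then obtain g where g: "P g" "\<forall>z\<in>S. iter_pderiv bs f z = g z" by auto
    obtain h where h: "P h" "\<forall>z\<in>S. pderiv_dir b g z = h z"
      using step[OF \<open>P g\<close>, of b] Cons.prems by auto
    have "pderiv_dir b (iter_pderiv bs f) z = pderiv_dir b g z" if "z \<in> S" for z
      using g(2) by (intro pderiv_dir_cong[OF S that]) auto
    with h show ?case by auto
  qed (use \<open>P f\<close> in auto)
  then show ?thesis
    unfolding smooth_on_def differentiable_on_eq_differentiable_at[OF S]
    using diff by (metis S differentiable_def has_derivative_transform_within_open)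
qed

text \<open>Finite sums of products are closed under partial derivatives by the Leibniz rule.\<close>

lemma smooth_on_bilinear:
  fixes f :: "'a::euclidean_space \<Rightarrow> 'b::real_normed_vector"
    and g :: "'a \<Rightarrow> 'c::real_normed_vector"
    and M :: "'b \<Rightarrow> 'c \<Rightarrow> 'd::real_normed_vector"
  assumes M: "bounded_bilinear M" and "smooth_on S f" "smooth_on S g" and S: "open S"
  shows "smooth_on S (\<lambda>z. M (f z) (g z))"
proof -
  let ?s = "\<lambda>L z. \<Sum>(f, g)\<leftarrow>L. M (f z) (g z)"
  let ?P = "\<lambda>h. \<exists>L. (\<forall>(f, g)\<in>set L. smooth_on S f \<and> smooth_on S g) \<and> h = ?s L"
  let ?D = "\<lambda>b L. concat (map (\<lambda>(f, g). [(f, pderiv_dir b g), (pderiv_dir b f, g)]) L)"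
  have deriv: "\<exists>h'. (?s L has_derivative h') (at z) \<and> (\<forall>b\<in>Basis. h' b = ?s (?D b L) z)"
    if "\<forall>(f, g)\<in>set L. smooth_on S f \<and> smooth_on S g" "z \<in> S" for L z
    using that
  proof (induction L)
    case Nil
    show ?case by (auto intro!: exI[of _ "\<lambda>_. 0"])
  next
    case (Cons p L)
    obtain f g where p: "p = (f, g)" by force
    obtain f' g' where d: "(f has_derivative f') (at z)" "(g has_derivative g') (at z)"
      using Cons.prems p smooth_on_differentiable[OF _ S \<open>z \<in> S\<close>, of f]
        smooth_on_differentiable[OF _ S \<open>z \<in> S\<close>, of g]
      by (auto simp: differentiable_def)
    obtain h' where h': "(?s L has_derivative h') (at z)" "\<forall>b\<in>Basis. h' b = ?s (?D b L) z"
      using Cons by auto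
    have "((\<lambda>z. M (f z) (g z) + ?s L z) has_derivative (\<lambda>h. M (f z) (g' h) + M (f' h) (g z) + h' h)) (at z)"
      by (intro has_derivative_add bounded_bilinear.FDERIV[OF M] d h')
    then show ?case
      using h'(2) by (auto simp: p pderiv_dir_eq[OF d(1)] pderiv_dir_eq[OF d(2)] intro!: exI add.assoc)
  qed
  show ?thesis
  proof (rule smooth_on_coinduct[of S ?P, OF S])
    show "?P (\<lambda>z. M (f z) (g z))"
      using assms by (intro exI[of _ "[(f, g)]"]) auto
    show "h differentiable (at z)" if h: "?P h" and z: "z \<in> S" for h z
    proof -
      obtain L where L: "\<forall>(f, g)\<in>set L. smooth_on S f \<and> smooth_on S g" "h = ?s L"
        using h by - (elim exE conjE, rule that)
      obtain h' where "(?s L has_derivative h') (at z)"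
        using deriv[OF L(1) z] by - (elim exE conjE, rule that)
      then show ?thesis unfolding L(2) differentiable_def by (rule exI[of _ h'])
    qed
    show "\<exists>k. ?P k \<and> (\<forall>z\<in>S. pderiv_dir b h z = k z)" if h: "?P h" and b: "b \<in> Basis" for h b
    proof -
      obtain L where L: "\<forall>(f, g)\<in>set L. smooth_on S f \<and> smooth_on S g" "h = ?s L"
        using h by - (elim exE conjE, rule that)
      have "\<forall>(f, g)\<in>set (?D b L). smooth_on S f \<and> smooth_on S g"
        using L(1) b by (auto intro: smooth_on_pderiv)
      moreover have "pderiv_dir b h z = ?s (?D b L) z" if z: "z \<in> S" for z
      proof -
        obtain h' where h': "(?s L has_derivative h') (at z)" "\<forall>b\<in>Basis. h' b = ?s (?D b L) z"
          using deriv[OF L(1) z] by - (elim exE conjE, rule that)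
        show ?thesis
          unfolding L(2) pderiv_dir_eq[OF h'(1)] by (rule bspec[OF h'(2) b])
      qed
      ultimately show ?thesis by (intro exI[of _ "?s (?D b L)"] conjI ballI) (rule exI, blast)
    qed
  qed
qed

lemma smooth_on_mult:
  fixes f g :: "'a::euclidean_space \<Rightarrow> 'b::real_normed_algebra"
  assumes "smooth_on S f" "smooth_on S g" "open S"
  shows "smooth_on S (\<lambda>z. f z * g z)"
  by (rule smooth_on_bilinear[OF bounded_bilinear_mult assms])

lemma smooth_on_power:
  fixes f :: "'a::euclidean_space \<Rightarrow> 'b::real_normed_algebra_1"
  assumes "smooth_on S f" "open S"
  shows "smooth_on S (\<lambda>z. f z ^ n)"
  by (induction n) (auto intro!: smooth_on_const smooth_on_mult assms)

lemma smooth_on_bounded_linear: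
  fixes f :: "'a::euclidean_space \<Rightarrow> 'b::real_normed_vector"
  assumes "bounded_linear f" "open S"
  shows "smooth_on S f"
proof (rule smooth_on_coinduct[of S "\<lambda>g. g = f \<or> (\<exists>c. g = (\<lambda>_. c))", OF \<open>open S\<close>])
  show "g differentiable (at z)" if "g = f \<or> (\<exists>c. g = (\<lambda>_. c))" for g z
    using that bounded_linear_imp_differentiable[OF assms(1)] by auto
  have "pderiv_dir b f = (\<lambda>_. f b)" "pderiv_dir b (\<lambda>_. c) = (\<lambda>_. 0)" for b and c :: 'b
    using pderiv_dir_eq[OF bounded_linear_imp_has_derivative[OF assms(1)]]
      pderiv_dir_eq[OF has_derivative_const, of b c] by auto
  then show "\<exists>k. (k = f \<or> (\<exists>c. k = (\<lambda>_. c))) \<and> (\<forall>z\<in>S. pderiv_dir b g z = k z)"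
    if "g = f \<or> (\<exists>c. g = (\<lambda>_. c))" for g b
    using that by metis
qed simp

text \<open>This serves the factor \<open>exp \<eta>\<close> of \<open>G1\<close>. The multiples of
  \<open>exp (l z)\<close> are stable under derivatives because the constant absorbs
  \<open>l b\<close>.\<close>

lemma smooth_on_exp:
  fixes l :: "'a::euclidean_space \<Rightarrow> real"
  assumes "bounded_linear l" "open S"
  shows "smooth_on S (\<lambda>z. exp (l z))"
proof (rule smooth_on_coinduct[of S "\<lambda>g. \<exists>c. g = (\<lambda>z. c * exp (l z))", OF \<open>open S\<close>])
  have deriv: "((\<lambda>z. c * exp (l z)) has_derivative (\<lambda>h. c * l h * exp (l z))) (at z)" for c z
    by (auto intro!: derivative_eq_intros bounded_linear_imp_has_derivative[OF assms(1)])
  show "g differentiable (at z)" if "\<exists>c. g = (\<lambda>z. c * exp (l z))" for g z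
    using that deriv by (auto simp: differentiable_def)
  show "\<exists>k. (\<exists>c. k = (\<lambda>z. c * exp (l z))) \<and> (\<forall>z\<in>S. pderiv_dir b g z = k z)"
    if "\<exists>c. g = (\<lambda>z. c * exp (l z))" for g b
    using that pderiv_dir_eq[OF deriv, of b] by fastforce
qed (rule exI[of _ 1], simp)

section \<open>Growth of nets\<close>

lemma Basis_plane: "(Basis :: (real \<times> real) set) = {(1, 0), (0, 1)}"
  by (auto simp: Basis_prod_def)

text \<open>Moderate nets are obtained with the rates \<open>C / \<epsilon>\<^sup>N\<close>, the negligible ones among them with
  the rates \<open>C \<epsilon>\<^sup>m\<close> for each \<open>m\<close>, so that closure properties need only be proved once.\<close>

definition rate_nets :: "(real \<Rightarrow> real) set \<Rightarrow> (real \<times> real) set \<Rightarrow> net set" where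
  "rate_nets R \<Omega> = {u.
     (\<forall>\<epsilon>\<in>{0<..1}. smooth_on \<Omega> (u \<epsilon>)) \<and>
     (\<forall>K bs. compact K \<and> K \<subseteq> \<Omega> \<and> set bs \<subseteq> Basis \<longrightarrow>
        (\<exists>r\<in>R. \<forall>\<^sub>F \<epsilon> in at_right 0. \<forall>z\<in>K. \<bar>iter_pderiv bs (u \<epsilon>) z\<bar> \<le> r \<epsilon>))}"

text \<open>This is what the triangle inequality for a linear combination of two nets requires;
  \<open>a\<close> and \<open>b\<close> stand for the absolute values of its coefficients.
  Domination rather than equality is asked because
  \<open>C1 / \<epsilon> ^ N1 + C2 / \<epsilon> ^ N2\<close> is in general not of the form
  \<open>C / \<epsilon> ^ N\<close>.\<close>

definition rate_cone :: "(real \<Rightarrow> real) set \<Rightarrow> bool" where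
  "rate_cone R \<longleftrightarrow> (\<forall>r1\<in>R. \<forall>r2\<in>R. \<forall>a\<ge>0. \<forall>b\<ge>0.
     \<exists>r\<in>R. \<forall>\<^sub>F \<epsilon> in at_right 0. a * r1 \<epsilon> + b * r2 \<epsilon> \<le> r \<epsilon>)"

lemma eventually_unit_interval: "\<forall>\<^sub>F \<epsilon> in at_right (0::real). \<epsilon> \<in> {0<..1}"
  using eventually_at_right_real[of 0 "1::real"] by (auto elim!: eventually_mono)

lemma rate_nets_smooth: "u \<in> rate_nets R \<Omega> \<Longrightarrow> \<epsilon> \<in> {0<..1} \<Longrightarrow> smooth_on \<Omega> (u \<epsilon>)"
  by (simp add: rate_nets_def)

lemma rate_nets_bound:
  assumes "u \<in> rate_nets R \<Omega>" "compact K" "K \<subseteq> \<Omega>" "set bs \<subseteq> Basis"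
  obtains r where "r \<in> R" "\<forall>\<^sub>F \<epsilon> in at_right 0. \<forall>z\<in>K. \<bar>iter_pderiv bs (u \<epsilon>) z\<bar> \<le> r \<epsilon>"
  using assms unfolding rate_nets_def by blast

lemma rate_netsI:
  assumes "\<And>\<epsilon>. \<epsilon> \<in> {0<..1} \<Longrightarrow> smooth_on \<Omega> (u \<epsilon>)"
    and "\<And>K bs. \<lbrakk>compact K; K \<subseteq> \<Omega>; set bs \<subseteq> Basis\<rbrakk> \<Longrightarrow>
      \<exists>r\<in>R. \<forall>\<^sub>F \<epsilon> in at_right 0. \<forall>z\<in>K. \<bar>iter_pderiv bs (u \<epsilon>) z\<bar> \<le> r \<epsilon>"
  shows "u \<in> rate_nets R \<Omega>"
  using assms by (simp add: rate_nets_def)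

lemma rate_nets_cong:
  assumes u: "u \<in> rate_nets R \<Omega>" and \<Omega>: "open \<Omega>"
    and eq: "\<And>\<epsilon> z. \<epsilon> \<in> {0<..1} \<Longrightarrow> z \<in> \<Omega> \<Longrightarrow> u \<epsilon> z = w \<epsilon> z"
  shows "w \<in> rate_nets R \<Omega>"
proof (rule rate_netsI)
  show "smooth_on \<Omega> (w \<epsilon>)" if "\<epsilon> \<in> {0<..1}" for \<epsilon>
    using smooth_on_cong[OF \<Omega> rate_nets_smooth[OF u that]] eq that by blast
  fix K and bs :: "(real \<times> real) list" assume *: "compact K" "K \<subseteq> \<Omega>" "set bs \<subseteq> Basis"
  obtain r where r: "r \<in> R" "\<forall>\<^sub>F \<epsilon> in at_right 0. \<forall>z\<in>K. \<bar>iter_pderiv bs (u \<epsilon>) z\<bar> \<le> r \<epsilon>"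
    using rate_nets_bound[OF u *] .
  have eq': "iter_pderiv bs (u \<epsilon>) z = iter_pderiv bs (w \<epsilon>) z"
    if "\<epsilon> \<in> {0<..1}" "z \<in> K" for \<epsilon> z
    using that * eq by (intro iter_pderiv_cong[OF \<Omega>]) auto
  have "\<forall>\<^sub>F \<epsilon> in at_right 0. \<forall>z\<in>K. \<bar>iter_pderiv bs (w \<epsilon>) z\<bar> \<le> r \<epsilon>"
    using eventually_unit_interval r(2) by eventually_elim (simp add: eq')
  with r(1) show "\<exists>r\<in>R. \<forall>\<^sub>F \<epsilon> in at_right 0. \<forall>z\<in>K. \<bar>iter_pderiv bs (w \<epsilon>) z\<bar> \<le> r \<epsilon>"
    by (intro bexI[of _ r])
qed

lemma rate_nets_pderiv:
  assumes u: "u \<in> rate_nets R \<Omega>" and b: "b \<in> Basis"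
  shows "(\<lambda>\<epsilon>. pderiv_dir b (u \<epsilon>)) \<in> rate_nets R \<Omega>"
proof (rule rate_netsI)
  show "smooth_on \<Omega> (pderiv_dir b (u \<epsilon>))" if "\<epsilon> \<in> {0<..1}" for \<epsilon>
    by (intro smooth_on_pderiv rate_nets_smooth[OF u] b that)
  fix K and bs :: "(real \<times> real) list" assume *: "compact K" "K \<subseteq> \<Omega>" "set bs \<subseteq> Basis"
  then have "set (bs @ [b]) \<subseteq> Basis" using b by simp
  from rate_nets_bound[OF u *(1,2) this]
  show "\<exists>r\<in>R. \<forall>\<^sub>F \<epsilon> in at_right 0. \<forall>z\<in>K. \<bar>iter_pderiv bs (pderiv_dir b (u \<epsilon>)) z\<bar> \<le> r \<epsilon>"
    unfolding iter_pderiv_snoc by blast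
qed

lemma rate_nets_lincomb:
  assumes R: "rate_cone R" and u: "u \<in> rate_nets R \<Omega>" and w: "w \<in> rate_nets R \<Omega>" and \<Omega>: "open \<Omega>"
  shows "(\<lambda>\<epsilon> z. a * u \<epsilon> z + b * w \<epsilon> z) \<in> rate_nets R \<Omega>"
proof (rule rate_netsI)
  have smooth: "smooth_on \<Omega> (\<lambda>z. a * u \<epsilon> z)" "smooth_on \<Omega> (\<lambda>z. b * w \<epsilon> z)" if "\<epsilon> \<in> {0<..1}" for \<epsilon>
    using rate_nets_smooth[OF u that] rate_nets_smooth[OF w that] \<Omega> by (auto intro: smooth_on_cmult)
  then show "smooth_on \<Omega> (\<lambda>z. a * u \<epsilon> z + b * w \<epsilon> z)" if "\<epsilon> \<in> {0<..1}" for \<epsilon>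
    using that \<Omega> by (auto intro: smooth_on_add)
  fix K and bs :: "(real \<times> real) list" assume *: "compact K" "K \<subseteq> \<Omega>" "set bs \<subseteq> Basis"
  obtain r1 where r1: "r1 \<in> R" "\<forall>\<^sub>F \<epsilon> in at_right 0. \<forall>z\<in>K. \<bar>iter_pderiv bs (u \<epsilon>) z\<bar> \<le> r1 \<epsilon>"
    using rate_nets_bound[OF u *] .
  obtain r2 where r2: "r2 \<in> R" "\<forall>\<^sub>F \<epsilon> in at_right 0. \<forall>z\<in>K. \<bar>iter_pderiv bs (w \<epsilon>) z\<bar> \<le> r2 \<epsilon>"
    using rate_nets_bound[OF w *] .
  obtain r where r': "r \<in> R" "\<forall>\<^sub>F \<epsilon> in at_right 0. \<bar>a\<bar> * r1 \<epsilon> + \<bar>b\<bar> * r2 \<epsilon> \<le> r \<epsilon>"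
    using R[unfolded rate_cone_def, rule_format, OF r1(1) r2(1) abs_ge_zero[of a] abs_ge_zero[of b]] ..
  have "\<forall>\<^sub>F \<epsilon> in at_right 0. \<forall>z\<in>K. \<bar>iter_pderiv bs (\<lambda>z. a * u \<epsilon> z + b * w \<epsilon> z) z\<bar> \<le> r \<epsilon>"
    using eventually_unit_interval r1(2) r2(2) r'(2)
  proof eventually_elim
    case (elim \<epsilon>)
    show ?case
    proof
      fix z assume z: "z \<in> K"
      then have z': "z \<in> \<Omega>" using * by auto
      have "iter_pderiv bs (\<lambda>z. a * u \<epsilon> z + b * w \<epsilon> z) z
          = a * iter_pderiv bs (u \<epsilon>) z + b * iter_pderiv bs (w \<epsilon>) z"
        using iter_pderiv_add[OF smooth[OF elim(1)] \<Omega> *(3) z']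
          iter_pderiv_cmult[OF rate_nets_smooth[OF u elim(1)] \<Omega> *(3) z']
          iter_pderiv_cmult[OF rate_nets_smooth[OF w elim(1)] \<Omega> *(3) z'] by simp
      also have "\<bar>\<dots>\<bar> \<le> \<bar>a\<bar> * \<bar>iter_pderiv bs (u \<epsilon>) z\<bar> + \<bar>b\<bar> * \<bar>iter_pderiv bs (w \<epsilon>) z\<bar>"
        by (metis abs_mult abs_triangle_ineq)
      also have "\<dots> \<le> \<bar>a\<bar> * r1 \<epsilon> + \<bar>b\<bar> * r2 \<epsilon>"
        using elim z by (intro add_mono mult_left_mono) auto
      finally show "\<bar>iter_pderiv bs (\<lambda>z. a * u \<epsilon> z + b * w \<epsilon> z) z\<bar> \<le> r \<epsilon>"
        using elim by simp
    qed
  qed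
  with r' show "\<exists>r\<in>R. \<forall>\<^sub>F \<epsilon> in at_right 0. \<forall>z\<in>K.
      \<bar>iter_pderiv bs (\<lambda>z. a * u \<epsilon> z + b * w \<epsilon> z) z\<bar> \<le> r \<epsilon>" by blast
qed

section \<open>Moderate and negligible growth as instances\<close>

definition moderate_rates :: "(real \<Rightarrow> real) set" where
  "moderate_rates = {r. \<exists>(N::nat) C. r = (\<lambda>\<epsilon>. C / \<epsilon> ^ N)}"

text \<open>The exponent is fixed because \<open>rate_nets\<close> asks for some rate of the set,
  whereas negligibility asks for a bound with every \<open>m\<close>; it is therefore an
  intersection over \<open>m\<close>.\<close>

definition power_rates :: "nat \<Rightarrow> (real \<Rightarrow> real) set" where
  "power_rates m = {r. \<exists>C. r = (\<lambda>\<epsilon>. C * \<epsilon> ^ m)}"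

lemma moderate_ratesI: "(\<lambda>\<epsilon>. C / \<epsilon> ^ N) \<in> moderate_rates"
  unfolding moderate_rates_def by blast

lemma power_ratesI: "(\<lambda>\<epsilon>. C * \<epsilon> ^ m) \<in> power_rates m"
  unfolding power_rates_def by blast

lemma bex_moderate_rates: "(\<exists>r\<in>moderate_rates. P r) \<longleftrightarrow> (\<exists>N C. P (\<lambda>\<epsilon>. C / \<epsilon> ^ N))"
  unfolding moderate_rates_def by blast

lemma bex_power_rates: "(\<exists>r\<in>power_rates m. P r) \<longleftrightarrow> (\<exists>C. P (\<lambda>\<epsilon>. C * \<epsilon> ^ m))"
  unfolding power_rates_def by blast

lemma moderate_nets_eq: "moderate_nets \<Omega> = rate_nets moderate_rates \<Omega>"
  unfolding moderate_nets_def rate_nets_def bex_moderate_rates ..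

lemma negligible_nets_eq:
  "negligible_nets \<Omega> = moderate_nets \<Omega> \<inter> (\<Inter>m. rate_nets (power_rates m) \<Omega>)"
proof (rule Set.set_eqI)
  fix u
  have "u \<in> negligible_nets \<Omega> \<longleftrightarrow> u \<in> moderate_nets \<Omega> \<and> (\<forall>m K bs. compact K \<and> K \<subseteq> \<Omega> \<and> set bs \<subseteq> Basis \<longrightarrow>
      (\<exists>C. \<forall>\<^sub>F \<epsilon> in at_right 0. \<forall>z\<in>K. \<bar>iter_pderiv bs (u \<epsilon>) z\<bar> \<le> C * \<epsilon> ^ m))"
    unfolding negligible_nets_def mem_Collect_eq by meson
  moreover have "\<forall>\<epsilon>\<in>{0<..1}. smooth_on \<Omega> (u \<epsilon>)" if "u \<in> moderate_nets \<Omega>"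
    using that unfolding moderate_nets_def mem_Collect_eq by (rule conjunct1)
  ultimately show "u \<in> negligible_nets \<Omega> \<longleftrightarrow> u \<in> moderate_nets \<Omega> \<inter> (\<Inter>m. rate_nets (power_rates m) \<Omega>)"
    unfolding rate_nets_def bex_power_rates Int_iff INT_iff mem_Collect_eq
    by (cases "u \<in> moderate_nets \<Omega>") simp_all
qed

lemma rate_cone_moderate: "rate_cone moderate_rates"
  unfolding rate_cone_def
proof (intro ballI allI impI)
  fix r1 r2 and a b :: real assume "r1 \<in> moderate_rates" "r2 \<in> moderate_rates" "a \<ge> 0" "b \<ge> 0"
  then obtain C1 C2 N1 N2 where r: "r1 = (\<lambda>\<epsilon>. C1 / \<epsilon> ^ N1)" "r2 = (\<lambda>\<epsilon>. C2 / \<epsilon> ^ N2)"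
    by (auto simp: moderate_rates_def)
  \<comment> \<open>For \<open>\<epsilon> \<le> 1\<close> the exponent \<open>N1 + N2\<close>
    dominates both rates. Absolute values are taken since \<open>C1\<close> and \<open>C2\<close>
    may be negative, in which case a larger exponent would decrease the quotient.\<close>
  let ?r = "\<lambda>\<epsilon>::real. (a * \<bar>C1\<bar> + b * \<bar>C2\<bar>) / \<epsilon> ^ (N1 + N2)"
  have le: "C / \<epsilon> ^ N \<le> \<bar>C\<bar> / \<epsilon> ^ (N + M)" if "\<epsilon> \<in> {0<..1}" for C \<epsilon> :: real and N M :: nat
  proof -
    have "\<epsilon> ^ (N + M) \<le> \<epsilon> ^ N" using that by (intro power_decreasing) auto
    then show ?thesis using that by (intro frac_le) auto
  qed
  have "\<forall>\<^sub>F \<epsilon> in at_right 0. a * r1 \<epsilon> + b * r2 \<epsilon> \<le> ?r \<epsilon>"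
    using eventually_unit_interval
  proof eventually_elim
    case (elim \<epsilon>)
    have "a * r1 \<epsilon> + b * r2 \<epsilon> \<le> a * (\<bar>C1\<bar> / \<epsilon> ^ (N1 + N2)) + b * (\<bar>C2\<bar> / \<epsilon> ^ (N1 + N2))"
      unfolding r using le[OF elim, of C1 N1 N2] le[OF elim, of C2 N2 N1] \<open>a \<ge> 0\<close> \<open>b \<ge> 0\<close>
      by (intro add_mono mult_left_mono) (simp_all add: add.commute)
    then show ?case by (simp add: add_divide_distrib)
  qed
  then show "\<exists>r\<in>moderate_rates. \<forall>\<^sub>F \<epsilon> in at_right 0. a * r1 \<epsilon> + b * r2 \<epsilon> \<le> r \<epsilon>"
    unfolding bex_moderate_rates by (intro exI)
qed

lemma rate_cone_power: "rate_cone (power_rates m)"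
  unfolding rate_cone_def
proof (intro ballI allI impI)
  fix r1 r2 and a b :: real assume "r1 \<in> power_rates m" "r2 \<in> power_rates m"
  then obtain C1 C2 where r: "r1 = (\<lambda>\<epsilon>. C1 * \<epsilon> ^ m)" "r2 = (\<lambda>\<epsilon>. C2 * \<epsilon> ^ m)"
    by (auto simp: power_rates_def)
  show "\<exists>r\<in>power_rates m. \<forall>\<^sub>F \<epsilon> in at_right 0. a * r1 \<epsilon> + b * r2 \<epsilon> \<le> r \<epsilon>"
    by (rule bexI[OF _ power_ratesI[of "a * C1 + b * C2"]]) (simp add: r algebra_simps)
qed

lemma moderate_nets_const: "(\<lambda>_ _. c) \<in> moderate_nets \<Omega>"
  unfolding moderate_nets_eq
proof (rule rate_netsI)
  show "\<exists>r\<in>moderate_rates. \<forall>\<^sub>F \<epsilon> in at_right 0. \<forall>z\<in>K. \<bar>iter_pderiv bs (\<lambda>_. c) z\<bar> \<le> r \<epsilon>"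
    for K and bs :: "(real \<times> real) list"
    by (rule bexI[OF _ moderate_ratesI[of "\<bar>c\<bar>" 0]]) (simp add: iter_pderiv_const)
qed (rule smooth_on_const)

lemma moderate_nets_lincomb:
  assumes "u \<in> moderate_nets \<Omega>" "w \<in> moderate_nets \<Omega>" "open \<Omega>"
  shows "(\<lambda>\<epsilon> z. a * u \<epsilon> z + b * w \<epsilon> z) \<in> moderate_nets \<Omega>"
  using rate_nets_lincomb[OF rate_cone_moderate assms[unfolded moderate_nets_eq]]
  unfolding moderate_nets_eq .

lemma negligible_nets_lincomb:
  assumes "u \<in> negligible_nets \<Omega>" "w \<in> negligible_nets \<Omega>" "open \<Omega>"
  shows "(\<lambda>\<epsilon> z. a * u \<epsilon> z + b * w \<epsilon> z) \<in> negligible_nets \<Omega>"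
proof -
  have "(\<lambda>\<epsilon> z. a * u \<epsilon> z + b * w \<epsilon> z) \<in> rate_nets (power_rates m) \<Omega>" for m
    by (rule rate_nets_lincomb[OF rate_cone_power _ _ assms(3)])
       (use assms(1,2) in \<open>simp_all add: negligible_nets_eq\<close>)
  moreover have "(\<lambda>\<epsilon> z. a * u \<epsilon> z + b * w \<epsilon> z) \<in> moderate_nets \<Omega>"
    by (rule moderate_nets_lincomb[OF _ _ assms(3)])
       (use assms(1,2) in \<open>simp_all add: negligible_nets_eq\<close>)
  ultimately show ?thesis by (simp add: negligible_nets_eq)
qed

lemma negligible_nets_zero: "(\<lambda>_ _. 0) \<in> negligible_nets \<Omega>"
proof -
  have "(\<lambda>_ _. 0) \<in> rate_nets (power_rates m) \<Omega>" for m
    by (intro rate_netsI bexI[OF _ power_ratesI[of 0]] smooth_on_const) (simp add: iter_pderiv_const)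
  then show ?thesis by (simp add: negligible_nets_eq moderate_nets_const)
qed

section \<open>Equality modulo negligible nets\<close>

lemma equiv_colombeau_rel:
  assumes "open \<Omega>"
  shows "equiv (moderate_nets \<Omega>) (colombeau_rel \<Omega>)"
proof (rule equivI)
  show "colombeau_rel \<Omega> \<subseteq> moderate_nets \<Omega> \<times> moderate_nets \<Omega>"
    by (auto simp: colombeau_rel_def)
  show "refl_on (moderate_nets \<Omega>) (colombeau_rel \<Omega>)"
    by (auto simp: refl_on_def colombeau_rel_def negligible_nets_zero)
  show "sym (colombeau_rel \<Omega>)"
  proof (rule symI)
    fix u w assume *: "(u, w) \<in> colombeau_rel \<Omega>"
    \<comment> \<open>The summand with factor \<open>0\<close> is padding: negation becomes an
      instance of the rule for two-term combinations.\<close>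
    then have "(\<lambda>\<epsilon> z. (-1) * (u \<epsilon> z - w \<epsilon> z) + 0 * (u \<epsilon> z - w \<epsilon> z)) \<in> negligible_nets \<Omega>"
      using assms by (intro negligible_nets_lincomb) (auto simp: colombeau_rel_def)
    with * show "(w, u) \<in> colombeau_rel \<Omega>" by (simp add: colombeau_rel_def)
  qed
  show "trans (colombeau_rel \<Omega>)"
  proof (rule transI)
    fix u v w assume *: "(u, v) \<in> colombeau_rel \<Omega>" "(v, w) \<in> colombeau_rel \<Omega>"
    then have "(\<lambda>\<epsilon> z. 1 * (u \<epsilon> z - v \<epsilon> z) + 1 * (v \<epsilon> z - w \<epsilon> z)) \<in> negligible_nets \<Omega>"
      using assms by (intro negligible_nets_lincomb) (auto simp: colombeau_rel_def)
    with * show "(u, w) \<in> colombeau_rel \<Omega>" by (simp add: colombeau_rel_def)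
  qed
qed

section \<open>Similarity and Galilean changes of the independent variables\<close>

definition galilei :: "real \<Rightarrow> real \<Rightarrow> real \<Rightarrow> real \<Rightarrow> real \<times> real \<Rightarrow> real \<times> real" where
  "galilei s k p q = (\<lambda>(x, t). (s * (x + k * t) + p, s * t + q))"

text \<open>Solving for \<open>(x, t)\<close> gives a map of the same family. One set of composition
  lemmas thus covers both directions: nets are composed with the inverse, test functions with the
  map itself.\<close>

abbreviation galilei_inv :: "real \<Rightarrow> real \<Rightarrow> real \<Rightarrow> real \<Rightarrow> real \<times> real \<Rightarrow> real \<times> real" where
  "galilei_inv s k p q \<equiv> galilei (1 / s) (- k) ((k * q - p) / s) (- (q / s))"

lemma galilei_left_inverse: "s \<noteq> 0 \<Longrightarrow> galilei_inv s k p q (galilei s k p q z) = z"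
  by (cases z) (simp add: galilei_def field_simps)

lemma galilei_right_inverse: "s \<noteq> 0 \<Longrightarrow> galilei s k p q (galilei_inv s k p q z) = z"
  by (cases z) (simp add: galilei_def field_simps)

lemma inj_galilei: "s \<noteq> 0 \<Longrightarrow> inj (galilei s k p q)"
  by (metis galilei_left_inverse injI)

text \<open>Writing the image as a preimage under a continuous map makes its openness
  immediate.\<close>

lemma galilei_image: "s \<noteq> 0 \<Longrightarrow> galilei s k p q ` S = galilei_inv s k p q -` S"
proof (intro Set.equalityI subsetI)
  show "z \<in> galilei s k p q ` S" if "s \<noteq> 0" "z \<in> galilei_inv s k p q -` S" for z
    using that galilei_right_inverse[of s k p q z] by (metis image_eqI vimage_eq)
qed (auto simp: galilei_left_inverse)

text \<open>Dropping the translation leaves the linear part, so \<open>galilei s k 0 0 b\<close> in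
  later formulas is the image of the direction \<open>b\<close>.\<close>

lemma galilei_has_derivative: "(galilei s k p q has_derivative galilei s k 0 0) (at z)"
proof -
  have *: "galilei s k p q = (\<lambda>z. (s * (fst z + k * snd z) + p, s * snd z + q))" for p q
    by (auto simp: galilei_def)
  show ?thesis unfolding * by (auto intro!: derivative_eq_intros)
qed

lemma continuous_on_galilei: "continuous_on S (galilei s k p q)"
  by (rule continuous_at_imp_continuous_on) (blast intro: has_derivative_continuous galilei_has_derivative)

lemma open_galilei_image: "s \<noteq> 0 \<Longrightarrow> open \<Omega> \<Longrightarrow> open (galilei s k p q ` \<Omega>)"
  by (simp add: galilei_image open_vimage continuous_on_galilei)

lemma compact_galilei_image: "compact K \<Longrightarrow> compact (galilei s k p q ` K)"
  by (intro compact_continuous_image continuous_on_galilei)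

text \<open>This is the chain rule. Its coefficients do not depend on \<open>z\<close>, so
  derivatives of a composite are again composites of linear combinations of derivatives, and
  iterating it never brings in the product rule.\<close>

lemma
  fixes f :: "real \<times> real \<Rightarrow> real"
  assumes "f differentiable (at (galilei s k p q z))"
  shows galilei_comp_differentiable: "(\<lambda>z. f (galilei s k p q z)) differentiable (at z)"
    and pderiv_dir_galilei: "pderiv_dir b (\<lambda>z. f (galilei s k p q z)) z =
      fst (galilei s k 0 0 b) * dx f (galilei s k p q z) +
      snd (galilei s k 0 0 b) * dt f (galilei s k p q z)"
proof -
  obtain f' where f': "(f has_derivative f') (at (galilei s k p q z))"
    using assms by (auto simp: differentiable_def)
  interpret bounded_linear f' using f' by (rule has_derivative_bounded_linear)
  have comp: "((\<lambda>z. f (galilei s k p q z)) has_derivative (\<lambda>h. f' (galilei s k 0 0 h))) (at z)"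
    using diff_chain_at[OF galilei_has_derivative f'] by (simp add: o_def)
  then show "(\<lambda>z. f (galilei s k p q z)) differentiable (at z)"
    by (auto simp: differentiable_def)
  have "f' (a, c) = a * f' (1, 0) + c * f' (0, 1)" for a c
    using add[of "a *\<^sub>R (1, 0)" "c *\<^sub>R (0, 1)"] scaleR[of a "(1, 0)"] scaleR[of c "(0, 1)"] by simp
  then show "pderiv_dir b (\<lambda>z. f (galilei s k p q z)) z =
      fst (galilei s k 0 0 b) * dx f (galilei s k p q z) +
      snd (galilei s k 0 0 b) * dt f (galilei s k p q z)"
    unfolding pderiv_dir_eq[OF comp] pderiv_dir_eq[OF f'] by (metis prod.collapse)
qed

lemma smooth_on_galilei:
  fixes f :: "real \<times> real \<Rightarrow> real"
  assumes "smooth_on T f" "open S" "open T" "galilei s k p q ` S \<subseteq> T"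
  shows "smooth_on S (\<lambda>z. f (galilei s k p q z))"
proof (rule smooth_on_coinduct[of S "\<lambda>h. \<exists>f. smooth_on T f \<and> h = (\<lambda>z. f (galilei s k p q z))"])
  show "h differentiable (at z)"
    if h: "\<exists>f. smooth_on T f \<and> h = (\<lambda>z. f (galilei s k p q z))" and z: "z \<in> S"
    for h :: "real \<times> real \<Rightarrow> real" and z
  proof -
    obtain f where f: "smooth_on T f" "h = (\<lambda>z. f (galilei s k p q z))" using h by auto
    show ?thesis
      unfolding f(2)
      by (rule galilei_comp_differentiable[of f, OF smooth_on_differentiable[OF f(1) \<open>open T\<close>]])
         (use z assms(4) in auto)
  qed
  show "\<exists>g. (\<exists>f. smooth_on T f \<and> g = (\<lambda>z. f (galilei s k p q z))) \<and> (\<forall>z\<in>S. pderiv_dir b h z = g z)"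
    if h: "\<exists>f. smooth_on T f \<and> h = (\<lambda>z. f (galilei s k p q z))"
    for h :: "real \<times> real \<Rightarrow> real" and b
  proof -
    obtain f where f: "smooth_on T f" "h = (\<lambda>z. f (galilei s k p q z))" using h by auto
    let ?g = "\<lambda>z. fst (galilei s k 0 0 b) * dx f z + snd (galilei s k 0 0 b) * dt f z"
    have "smooth_on T ?g"
      using f(1) \<open>open T\<close>
      by (intro smooth_on_add smooth_on_cmult smooth_on_pderiv) (auto simp: Basis_plane)
    moreover have "pderiv_dir b h z = ?g (galilei s k p q z)" if "z \<in> S" for z
      unfolding f(2) using that assms(4)
      by (intro pderiv_dir_galilei smooth_on_differentiable[OF f(1) \<open>open T\<close>]) auto
    ultimately show ?thesis
      by (intro exI[of _ "\<lambda>z. ?g (galilei s k p q z)"] conjI ballI exI[of _ ?g]) auto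
  qed
qed (use assms in auto)

lemma rate_nets_galilei:
  assumes R: "rate_cone R" and u: "u \<in> rate_nets R T"
    and S: "open S" and T: "open T" and ST: "galilei s k p q ` S \<subseteq> T"
  shows "(\<lambda>\<epsilon> z. u \<epsilon> (galilei s k p q z)) \<in> rate_nets R S"
proof (rule rate_netsI)
  show "smooth_on S (\<lambda>z. u \<epsilon> (galilei s k p q z))" if "\<epsilon> \<in> {0<..1}" for \<epsilon>
    using smooth_on_galilei[OF rate_nets_smooth[OF u that] S T ST] .
  \<comment> \<open>Every iterated derivative of the composite is some net \<open>w\<close> of the
    same growth composed with the map. The induction removes the innermost derivative: by the chain
    rule it replaces \<open>u\<close> by \<open>?u'\<close>, which has the same growth, so
    \<open>u\<close> must be arbitrary.\<close>
  have transfer: "\<exists>w\<in>rate_nets R T. \<forall>\<epsilon>\<in>{0<..1}. \<forall>z\<in>S.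
      iter_pderiv bs (\<lambda>z. u \<epsilon> (galilei s k p q z)) z = w \<epsilon> (galilei s k p q z)"
    if "set bs \<subseteq> Basis" "u \<in> rate_nets R T" for bs and u :: net
    using that
  proof (induction bs arbitrary: u rule: rev_induct)
    case (snoc b bs)
    let ?u' = "\<lambda>\<epsilon> z. fst (galilei s k 0 0 b) * dx (u \<epsilon>) z + snd (galilei s k 0 0 b) * dt (u \<epsilon>) z"
    have u': "?u' \<in> rate_nets R T"
      using snoc.prems T by (intro rate_nets_lincomb[OF R] rate_nets_pderiv) (auto simp: Basis_plane)
    then obtain w where w: "w \<in> rate_nets R T" "\<forall>\<epsilon>\<in>{0<..1}. \<forall>z\<in>S.
        iter_pderiv bs (\<lambda>z. ?u' \<epsilon> (galilei s k p q z)) z = w \<epsilon> (galilei s k p q z)"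
      using snoc.IH[OF _ u'] snoc.prems by auto
    have "iter_pderiv (bs @ [b]) (\<lambda>z. u \<epsilon> (galilei s k p q z)) z
        = iter_pderiv bs (\<lambda>z. ?u' \<epsilon> (galilei s k p q z)) z" if "\<epsilon> \<in> {0<..1}" "z \<in> S" for \<epsilon> z
      unfolding iter_pderiv_snoc using ST
      by (intro iter_pderiv_cong[OF S \<open>z \<in> S\<close>] pderiv_dir_galilei
            smooth_on_differentiable[OF rate_nets_smooth[OF snoc.prems(2) that(1)] T]) auto
    with w show ?case by auto
  qed auto
  fix K and bs :: "(real \<times> real) list" assume K: "compact K" "K \<subseteq> S" and bs: "set bs \<subseteq> Basis"
  obtain w where w: "w \<in> rate_nets R T" "\<And>\<epsilon> z. \<epsilon>\<in>{0<..1} \<Longrightarrow> z\<in>S \<Longrightarrow>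
      iter_pderiv bs (\<lambda>z. u \<epsilon> (galilei s k p q z)) z = w \<epsilon> (galilei s k p q z)"
    using transfer[OF bs u] by blast
  \<comment> \<open>All derivatives are absorbed in \<open>w\<close>, so its bound of order zero on
    the compact image of \<open>K\<close> suffices.\<close>
  obtain r where r: "r \<in> R" "\<forall>\<^sub>F \<epsilon> in at_right 0. \<forall>z\<in>galilei s k p q ` K. \<bar>iter_pderiv [] (w \<epsilon>) z\<bar> \<le> r \<epsilon>"
    by (rule rate_nets_bound[OF w(1) compact_galilei_image[OF K(1)], of s k p q "[]"])
       (use ST K(2) in auto)
  have "\<forall>\<^sub>F \<epsilon> in at_right 0. \<forall>z\<in>K. \<bar>iter_pderiv bs (\<lambda>z. u \<epsilon> (galilei s k p q z)) z\<bar> \<le> r \<epsilon>"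
    using eventually_unit_interval r(2) by eventually_elim (use w(2) K(2) in auto)
  with r(1) show "\<exists>r\<in>R. \<forall>\<^sub>F \<epsilon> in at_right 0. \<forall>z\<in>K.
      \<bar>iter_pderiv bs (\<lambda>z. u \<epsilon> (galilei s k p q z)) z\<bar> \<le> r \<epsilon>" by blast
qed

lemma moderate_nets_galilei:
  assumes "u \<in> moderate_nets T" "open S" "open T" "galilei s k p q ` S \<subseteq> T"
  shows "(\<lambda>\<epsilon> z. u \<epsilon> (galilei s k p q z)) \<in> moderate_nets S"
  using rate_nets_galilei[OF rate_cone_moderate assms[unfolded moderate_nets_eq]]
  unfolding moderate_nets_eq .

lemma negligible_nets_galilei:
  assumes "u \<in> negligible_nets T" "open S" "open T" "galilei s k p q ` S \<subseteq> T"
  shows "(\<lambda>\<epsilon> z. u \<epsilon> (galilei s k p q z)) \<in> negligible_nets S"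
proof -
  have "(\<lambda>\<epsilon> z. u \<epsilon> (galilei s k p q z)) \<in> rate_nets (power_rates m) S" for m
    by (rule rate_nets_galilei[OF rate_cone_power _ assms(2-4)])
       (use assms(1) in \<open>simp add: negligible_nets_eq\<close>)
  moreover have "(\<lambda>\<epsilon> z. u \<epsilon> (galilei s k p q z)) \<in> moderate_nets S"
    by (rule moderate_nets_galilei[OF _ assms(2-4)]) (use assms(1) in \<open>simp add: negligible_nets_eq\<close>)
  ultimately show ?thesis by (simp add: negligible_nets_eq)
qed

section \<open>The transformed nets\<close>

text \<open>The parameter \<open>d\<close> is free, since adding a constant to \<open>v\<close>
  changes neither equation. In \<open>G3\<close> it is \<open>\<eta>\<^sup>2 / 2\<close>, which
  supplies the cross term \<open>\<eta> * \<theta>\<close> arising when two boosts are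
  composed.\<close>

definition galilei_transf :: "real \<Rightarrow> real \<Rightarrow> real \<Rightarrow> real \<Rightarrow> real \<Rightarrow> transf" where
  "galilei_transf s k p q d = (\<lambda>(z, (u, v)). (galilei s k p q z, (u + k, v + k * u + d)))"

lemma base_map_galilei [simp]: "base_map (galilei_transf s k p q d) = galilei s k p q"
  by (auto simp: base_map_def galilei_transf_def)

lemma projectable_galilei: "projectable (galilei_transf s k p q d)"
  unfolding projectable_def base_map_galilei by (auto simp: galilei_transf_def)

text \<open>The base map is injective on the whole plane, so on the image of \<open>\<Omega>\<close>
  the choice made by \<open>inv_into\<close> is the explicit inverse.\<close>

lemma act_fun_galilei:
  assumes "s \<noteq> 0" "z \<in> galilei s k p q ` \<Omega>"
  shows "act_fun (galilei_transf s k p q d) \<Omega> f z =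
    (fst (f (galilei_inv s k p q z)) + k,
     snd (f (galilei_inv s k p q z)) + k * fst (f (galilei_inv s k p q z)) + d)"
proof -
  obtain y where y: "y \<in> \<Omega>" "z = galilei s k p q y" using assms by auto
  have "inv_into \<Omega> (galilei s k p q) z = galilei_inv s k p q z"
    using y inj_on_subset[OF inj_galilei[OF \<open>s \<noteq> 0\<close>] subset_UNIV]
    by (simp add: galilei_left_inverse[OF \<open>s \<noteq> 0\<close>])
  then show ?thesis
    unfolding act_fun_def base_map_galilei o_def
    by (simp add: fibre_map_def galilei_transf_def split_beta)
qed

lemma act_net1_galilei:
  assumes "s \<noteq> 0" "z \<in> galilei s k p q ` \<Omega>"
  shows "act_net1 (galilei_transf s k p q d) \<Omega> u v \<epsilon> z = u \<epsilon> (galilei_inv s k p q z) + k"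
  using act_fun_galilei[OF assms] by (simp add: act_net1_def)

lemma act_net2_galilei:
  assumes "s \<noteq> 0" "z \<in> galilei s k p q ` \<Omega>"
  shows "act_net2 (galilei_transf s k p q d) \<Omega> u v \<epsilon> z =
    v \<epsilon> (galilei_inv s k p q z) + k * u \<epsilon> (galilei_inv s k p q z) + d"
  using act_fun_galilei[OF assms] by (simp add: act_net2_def)

lemma galilei_inv_image: "s \<noteq> 0 \<Longrightarrow> galilei_inv s k p q ` galilei s k p q ` \<Omega> \<subseteq> \<Omega>"
  by (auto simp: galilei_left_inverse)

lemma
  assumes s: "s \<noteq> 0" and \<Omega>: "open \<Omega>" and u: "u \<in> moderate_nets \<Omega>" and v: "v \<in> moderate_nets \<Omega>"
  shows moderate_act_net1:
      "act_net1 (galilei_transf s k p q d) \<Omega> u v \<in> moderate_nets (galilei s k p q ` \<Omega>)"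
    and moderate_act_net2:
      "act_net2 (galilei_transf s k p q d) \<Omega> u v \<in> moderate_nets (galilei s k p q ` \<Omega>)"
proof -
  let ?g = "galilei_inv s k p q" and ?T = "galilei s k p q ` \<Omega>"
  have T: "open ?T" using open_galilei_image[OF s \<Omega>] .
  have comp: "(\<lambda>\<epsilon> z. w \<epsilon> (?g z)) \<in> moderate_nets ?T" if "w \<in> moderate_nets \<Omega>" for w
    using moderate_nets_galilei[OF that T \<Omega> galilei_inv_image[OF s]] .
  \<comment> \<open>The shift by \<open>k\<close> is read as \<open>k\<close> times the constant net
    \<open>1\<close>, to fit the two-term rule.\<close>
  have "(\<lambda>\<epsilon> z. 1 * u \<epsilon> (?g z) + k * 1) \<in> moderate_nets ?T"
    by (intro moderate_nets_lincomb comp u moderate_nets_const T)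
  then show "act_net1 (galilei_transf s k p q d) \<Omega> u v \<in> moderate_nets ?T"
    unfolding moderate_nets_eq
    by (rule rate_nets_cong[OF _ T]) (simp add: act_net1_galilei[OF s])
  have "(\<lambda>\<epsilon> z. 1 * (1 * v \<epsilon> (?g z) + k * u \<epsilon> (?g z)) + d * 1) \<in> moderate_nets ?T"
    by (intro moderate_nets_lincomb comp u v moderate_nets_const T)
  then show "act_net2 (galilei_transf s k p q d) \<Omega> u v \<in> moderate_nets ?T"
    unfolding moderate_nets_eq
    by (rule rate_nets_cong[OF _ T]) (simp add: act_net2_galilei[OF s])
qed

lemma negligible_nets_cong:
  assumes "u \<in> negligible_nets \<Omega>" "open \<Omega>"
    and "\<And>\<epsilon> z. \<epsilon> \<in> {0<..1} \<Longrightarrow> z \<in> \<Omega> \<Longrightarrow> u \<epsilon> z = w \<epsilon> z"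
  shows "w \<in> negligible_nets \<Omega>"
  using assms rate_nets_cong[OF _ assms(2,3)] by (simp add: negligible_nets_eq moderate_nets_eq)

text \<open>The constants \<open>k\<close> and \<open>d\<close> cancel in differences of images,
  leaving linear combinations of the negligible differences \<open>u - u'\<close> and
  \<open>v - v'\<close> composed with the inverse.\<close>

lemma colombeau_rel_act_net:
  fixes k p q d :: real
  assumes s: "s \<noteq> 0" and \<Omega>: "open \<Omega>"
    and u: "(u, u') \<in> colombeau_rel \<Omega>" and v: "(v, v') \<in> colombeau_rel \<Omega>"
  defines "G \<equiv> galilei_transf s k p q d"
  shows "(act_net1 G \<Omega> u v, act_net1 G \<Omega> u' v') \<in> colombeau_rel (galilei s k p q ` \<Omega>)"
    and "(act_net2 G \<Omega> u v, act_net2 G \<Omega> u' v') \<in> colombeau_rel (galilei s k p q ` \<Omega>)"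
proof -
  let ?g = "galilei_inv s k p q" and ?T = "galilei s k p q ` \<Omega>"
  have T: "open ?T" using open_galilei_image[OF s \<Omega>] .
  have comp: "(\<lambda>\<epsilon> z. w \<epsilon> (?g z) - w' \<epsilon> (?g z)) \<in> negligible_nets ?T"
    if "(w, w') \<in> colombeau_rel \<Omega>" for w w'
    using that negligible_nets_galilei[of "\<lambda>\<epsilon> z. w \<epsilon> z - w' \<epsilon> z", OF _ T \<Omega> galilei_inv_image[OF s]]
    by (simp add: colombeau_rel_def)
  have mod: "u \<in> moderate_nets \<Omega>" "u' \<in> moderate_nets \<Omega>" "v \<in> moderate_nets \<Omega>" "v' \<in> moderate_nets \<Omega>"
    using u v by (auto simp: colombeau_rel_def)
  have "(\<lambda>\<epsilon> z. act_net1 G \<Omega> u v \<epsilon> z - act_net1 G \<Omega> u' v' \<epsilon> z) \<in> negligible_nets ?T"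
    unfolding G_def
    by (rule negligible_nets_cong[OF comp[OF u] T]) (simp add: act_net1_galilei[OF s])
  then show "(act_net1 G \<Omega> u v, act_net1 G \<Omega> u' v') \<in> colombeau_rel ?T"
    using moderate_act_net1[OF s \<Omega>] mod by (simp add: colombeau_rel_def G_def)
  have "(\<lambda>\<epsilon> z. 1 * (v \<epsilon> (?g z) - v' \<epsilon> (?g z)) + k * (u \<epsilon> (?g z) - u' \<epsilon> (?g z))) \<in> negligible_nets ?T"
    by (intro negligible_nets_lincomb comp u v T)
  then have "(\<lambda>\<epsilon> z. act_net2 G \<Omega> u v \<epsilon> z - act_net2 G \<Omega> u' v' \<epsilon> z) \<in> negligible_nets ?T"
    unfolding G_def
    by (rule negligible_nets_cong[OF _ T]) (simp add: act_net2_galilei[OF s] algebra_simps)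
  then show "(act_net2 G \<Omega> u v, act_net2 G \<Omega> u' v') \<in> colombeau_rel ?T"
    using moderate_act_net2[OF s \<Omega>] mod by (simp add: colombeau_rel_def G_def)
qed

lemma act_gen_defined_galilei:
  assumes "s \<noteq> 0" "open \<Omega>" "F \<in> colombeau \<Omega> \<times> colombeau \<Omega>"
  shows "act_gen_defined (galilei_transf s k p q d) \<Omega> F"
proof -
  have "(u, u') \<in> colombeau_rel \<Omega>" if "X \<in> colombeau \<Omega>" "u \<in> X" "u' \<in> X" for X u u'
    using in_quotient_imp_in_rel[OF equiv_colombeau_rel[OF \<open>open \<Omega>\<close>]] that
    by (auto simp: colombeau_def)
  then show ?thesis
    using assms inj_on_subset[OF inj_galilei[OF \<open>s \<noteq> 0\<close>] subset_UNIV]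
    by (auto simp: act_gen_defined_def intro!: colombeau_rel_act_net)
qed

lemma act_gen_class:
  assumes "act_gen_defined g \<Omega> F" "open (base_map g ` \<Omega>)" "u \<in> fst F" "v \<in> snd F"
  shows "act_gen g \<Omega> F =
    (colombeau_rel (base_map g ` \<Omega>) `` {act_net1 g \<Omega> u v},
     colombeau_rel (base_map g ` \<Omega>) `` {act_net2 g \<Omega> u v})"
proof -
  note eq = equiv_class_eq[OF equiv_colombeau_rel[OF assms(2)]]
  have "colombeau_rel (base_map g ` \<Omega>) `` {act_net1 g \<Omega> u' v'} =
      colombeau_rel (base_map g ` \<Omega>) `` {act_net1 g \<Omega> u v}"
    "colombeau_rel (base_map g ` \<Omega>) `` {act_net2 g \<Omega> u' v'} =
      colombeau_rel (base_map g ` \<Omega>) `` {act_net2 g \<Omega> u v}"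
    if "u' \<in> fst F" "v' \<in> snd F" for u' v'
    by (rule eq; use assms that in \<open>simp add: act_gen_defined_def\<close>)+
  then have "(\<Union>u'\<in>fst F. \<Union>v'\<in>snd F. colombeau_rel (base_map g ` \<Omega>) `` {act_net1 g \<Omega> u' v'}) =
      (\<Union>u'\<in>fst F. \<Union>v'\<in>snd F. colombeau_rel (base_map g ` \<Omega>) `` {act_net1 g \<Omega> u v})"
    "(\<Union>u'\<in>fst F. \<Union>v'\<in>snd F. colombeau_rel (base_map g ` \<Omega>) `` {act_net2 g \<Omega> u' v'}) =
      (\<Union>u'\<in>fst F. \<Union>v'\<in>snd F. colombeau_rel (base_map g ` \<Omega>) `` {act_net2 g \<Omega> u v})"
    by (intro SUP_cong refl; simp)+
  \<comment> \<open>A union of copies of one class is that class only over a nonempty index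
    set.\<close>
  moreover have "fst F \<noteq> {}" "snd F \<noteq> {}" using assms(3,4) by auto
  ultimately show ?thesis unfolding act_gen_def by simp
qed

section \<open>Transformation of the system\<close>

text \<open>Differentiating the fluxes gives the non-conservative form, in which only the first
  derivatives of \<open>u\<close> and \<open>v\<close> have to be transformed.\<close>

lemma Delta_eq:
  assumes "u differentiable (at z)" "v differentiable (at z)"
  shows "Delta1 u v z = dt u z + 2 * u z * dx u z - dx v z"
    and "Delta2 u v z = dt v z + ((u z)\<^sup>2 - 1) * dx u z"
proof -
  obtain u' v' where d: "(u has_derivative u') (at z)" "(v has_derivative v') (at z)"
    using assms by (auto simp: differentiable_def)
  have "((\<lambda>y. (u y)\<^sup>2 - v y) has_derivative (\<lambda>h. 2 * u z * u' h - v' h)) (at z)"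
    by (auto intro!: derivative_eq_intros d)
  moreover have "((\<lambda>y. 1 / 3 * (u y) ^ 3 - u y) has_derivative (\<lambda>h. ((u z)\<^sup>2 - 1) * u' h)) (at z)"
    by (auto intro!: derivative_eq_intros d simp: power2_eq_square algebra_simps)
  ultimately show "Delta1 u v z = dt u z + 2 * u z * dx u z - dx v z"
    "Delta2 u v z = dt v z + ((u z)\<^sup>2 - 1) * dx u z"
    by (simp_all add: Delta1_def Delta2_def pderiv_dir_eq[OF d(1)] pderiv_dir_eq[OF d(2)] pderiv_dir_eq)
qed

lemma smooth_on_Delta:
  assumes "smooth_on \<Omega> u" "smooth_on \<Omega> v" "open \<Omega>"
  shows "smooth_on \<Omega> (Delta1 u v)" "smooth_on \<Omega> (Delta2 u v)"
  unfolding Delta1_def Delta2_def using assms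
  by (intro smooth_on_add smooth_on_pderiv smooth_on_diff smooth_on_cmult smooth_on_power;
      simp add: Basis_plane)+

text \<open>At corresponding points \<open>s * dx U = dx u\<close>,
  \<open>s * dt U = dt u - k * dx u\<close>, and likewise for \<open>V\<close> with
  \<open>v + k * u\<close> in place of \<open>u\<close>. In \<open>Delta1\<close> the terms with
  \<open>k\<close> are \<open>- k + 2 * k - k\<close> times \<open>dx u\<close> and cancel. In
  \<open>Delta2\<close> the terms with the square of \<open>k\<close> cancel, and those linear in
  \<open>k\<close> assemble to \<open>k * Delta1 u v\<close>.\<close>

lemma Delta_galilei:
  assumes s: "s \<noteq> 0" and \<Omega>: "open \<Omega>" and u: "smooth_on \<Omega> u" and v: "smooth_on \<Omega> v"
    and U: "\<And>z. z \<in> galilei s k p q ` \<Omega> \<Longrightarrow> U z = u (galilei_inv s k p q z) + k"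
    and V: "\<And>z. z \<in> galilei s k p q ` \<Omega> \<Longrightarrow>
      V z = v (galilei_inv s k p q z) + k * u (galilei_inv s k p q z) + d"
    and y: "y \<in> \<Omega>"
  shows "Delta1 U V (galilei s k p q y) = Delta1 u v y / s"
    and "Delta2 U V (galilei s k p q y) = (Delta2 u v y + k * Delta1 u v y) / s"
proof -
  let ?g = "galilei_inv s k p q" and ?T = "galilei s k p q ` \<Omega>" and ?z = "galilei s k p q y"
  have T: "open ?T" and z: "?z \<in> ?T" and gz: "?g ?z = y"
    using open_galilei_image[OF s \<Omega>] y by (auto simp: galilei_left_inverse[OF s])
  have du: "u differentiable (at (?g ?z))" and dv: "v differentiable (at (?g ?z))"
    using smooth_on_differentiable[OF u \<Omega> y] smooth_on_differentiable[OF v \<Omega> y] by (simp_all add: gz)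
  obtain u' v' where
    u': "((\<lambda>z. u (?g z)) has_derivative u') (at ?z)" and
    v': "((\<lambda>z. v (?g z)) has_derivative v') (at ?z)"
    using galilei_comp_differentiable[OF du] galilei_comp_differentiable[OF dv]
    by (auto simp: differentiable_def)
  have "((\<lambda>z. u (?g z) + k) has_derivative u') (at ?z)"
    using u' by (auto intro!: derivative_eq_intros)
  \<comment> \<open>The formula for \<open>U\<close> holds only on \<open>?T\<close>, whose openness
    lets the derivative pass over.\<close>
  from has_derivative_transform_within_open[OF this T z U[symmetric]]
  have dU: "(U has_derivative u') (at ?z)" by simp
  have "((\<lambda>z. v (?g z) + k * u (?g z) + d) has_derivative (\<lambda>h. v' h + k * u' h)) (at ?z)"
    using u' v' by (auto intro!: derivative_eq_intros)
  from has_derivative_transform_within_open[OF this T z V[symmetric]]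
  have dV: "(V has_derivative (\<lambda>h. v' h + k * u' h)) (at ?z)" by simp
  have dxt: "u' (1, 0) = dx u y / s" "u' (0, 1) = dt u y / s - k * dx u y / s"
    "v' (1, 0) = dx v y / s" "v' (0, 1) = dt v y / s - k * dx v y / s"
    using pderiv_dir_galilei[OF du, of "(1, 0)"] pderiv_dir_galilei[OF du, of "(0, 1)"]
      pderiv_dir_galilei[OF dv, of "(1, 0)"] pderiv_dir_galilei[OF dv, of "(0, 1)"]
    unfolding pderiv_dir_eq[OF u'] pderiv_dir_eq[OF v'] gz by (simp_all add: galilei_def)
  have UV: "U differentiable (at ?z)" "V differentiable (at ?z)"
    using dU dV by (auto simp: differentiable_def)
  have uv: "u differentiable (at y)" "v differentiable (at y)" using du dv by (simp_all add: gz)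
  have Uz: "U ?z = u y + k" using U[OF z] by (simp add: gz)
  show "Delta1 U V ?z = Delta1 u v y / s"
    unfolding Delta_eq[OF UV] Delta_eq[OF uv] pderiv_dir_eq[OF dU] pderiv_dir_eq[OF dV] Uz dxt
    using s by (simp add: field_simps)
  show "Delta2 U V ?z = (Delta2 u v y + k * Delta1 u v y) / s"
    unfolding Delta_eq[OF UV] Delta_eq[OF uv] pderiv_dir_eq[OF dU] pderiv_dir_eq[OF dV] Uz dxt
    using s by (simp add: field_simps power2_eq_square)
qed

lemma classical_solution_galilei:
  assumes s: "s \<noteq> 0" and f: "classical_solution \<Omega> f"
  shows "classical_solution (galilei s k p q ` \<Omega>) (act_fun (galilei_transf s k p q d) \<Omega> f)"
proof -
  let ?g = "galilei_inv s k p q" and ?T = "galilei s k p q ` \<Omega>"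
  let ?h = "act_fun (galilei_transf s k p q d) \<Omega> f"
  let ?u = "fst \<circ> f" and ?v = "snd \<circ> f"
  have \<Omega>: "open \<Omega>" and sf: "smooth_on \<Omega> f" using f by (auto simp: classical_solution_def)
  have T: "open ?T" using open_galilei_image[OF s \<Omega>] .
  have u: "smooth_on \<Omega> ?u" and v: "smooth_on \<Omega> ?v"
    using smooth_on_linear[OF bounded_linear_fst sf \<Omega>] smooth_on_linear[OF bounded_linear_snd sf \<Omega>]
    by (simp_all add: o_def)
  have U: "(fst \<circ> ?h) z = ?u (?g z) + k" and V: "(snd \<circ> ?h) z = ?v (?g z) + k * ?u (?g z) + d"
    if "z \<in> ?T" for z
    using act_fun_galilei[OF s that] by auto
  have comp: "smooth_on ?T (\<lambda>z. w (?g z))" if "smooth_on \<Omega> w" for w :: "real \<times> real \<Rightarrow> real"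
    using smooth_on_galilei[OF that T \<Omega> galilei_inv_image[OF s]] .
  have "smooth_on ?T (\<lambda>z. (?u (?g z) + k, ?v (?g z) + k * ?u (?g z) + d))"
    by (intro smooth_on_Pair smooth_on_add smooth_on_cmult smooth_on_const comp u v T)
  then have "smooth_on ?T ?h"
    by (rule smooth_on_cong[OF T]) (simp add: act_fun_galilei[OF s])
  moreover have "Delta1 (fst \<circ> ?h) (snd \<circ> ?h) z = 0 \<and> Delta2 (fst \<circ> ?h) (snd \<circ> ?h) z = 0"
    if z: "z \<in> ?T" for z
  proof -
    obtain y where y: "y \<in> \<Omega>" "z = galilei s k p q y" using z by auto
    then show ?thesis
      using f Delta_galilei[OF s \<Omega> u v, of k p q "fst \<circ> ?h" "snd \<circ> ?h" d y, OF U V y(1)]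
      unfolding classical_solution_def by simp
  qed
  ultimately show ?thesis using T by (simp add: classical_solution_def)
qed

section \<open>Weak formulation\<close>

lemma test_functions_continuous: "\<phi> \<in> test_functions \<Omega> \<Longrightarrow> continuous_on S \<phi>"
  unfolding test_functions_def using smooth_on_continuous continuous_on_subset by blast

text \<open>The function \<open>w\<close> may be unbounded near the boundary of
  \<open>\<Omega>\<close>, but the product lives on the compact support of \<open>\<phi>\<close>
  inside \<open>\<Omega>\<close>, where it is continuous.\<close>

lemma integrable_test_function:
  assumes "continuous_on \<Omega> w" "\<phi> \<in> test_functions \<Omega>"
  shows "set_integrable lborel \<Omega> (\<lambda>z. w z * \<phi> z)"
proof -
  let ?K = "closure {z. \<phi> z \<noteq> 0}"
  have K: "compact ?K" "?K \<subseteq> \<Omega>" using assms(2) by (auto simp: test_functions_def)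
  have "continuous_on ?K (\<lambda>z. w z * \<phi> z)"
    by (rule continuous_on_mult[OF continuous_on_subset[OF assms(1) K(2)] test_functions_continuous[OF assms(2)]])
  from borel_integrable_compact[OF K(1) this]
  have "integrable lborel (\<lambda>z. indicator ?K z *\<^sub>R (w z * \<phi> z))" .
  moreover have "indicator ?K z *\<^sub>R (w z * \<phi> z) = indicator \<Omega> z *\<^sub>R (w z * \<phi> z)" for z
    using K(2) closure_subset[of "{z. \<phi> z \<noteq> 0}"] by (auto simp: indicator_def)
  ultimately show ?thesis by (simp only: set_integrable_def)
qed

text \<open>By Fubini the integral over \<open>x\<close> is done first. For fixed \<open>t\<close>
  the boost is a mere translation in \<open>x\<close>, so each variable contributes one factor
  \<open>\<bar>s\<bar>\<close>. Fubini is applied to \<open>f\<close> and to the composite, hence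
  the two integrability assumptions.\<close>

lemma integral_galilei:
  fixes f :: "real \<times> real \<Rightarrow> real"
  assumes s: "s \<noteq> 0" and f: "integrable lborel f" and fg: "integrable lborel (\<lambda>z. f (galilei s k p q z))"
  shows "(\<integral>z. f z \<partial>lborel) = s\<^sup>2 * (\<integral>z. f (galilei s k p q z) \<partial>lborel)"
proof -
  have fubini: "(\<integral>z. h z \<partial>lborel) = (\<integral>t. (\<integral>x. h (x, t) \<partial>lborel) \<partial>lborel)"
    if "integrable lborel h" for h :: "real \<times> real \<Rightarrow> real"
    using lborel_pair.integral_snd[of "\<lambda>x t. h (x, t)"] that by (simp add: lborel_prod)
  have "(\<integral>z. f z \<partial>lborel) = (\<integral>t. (\<integral>x. f (x, t) \<partial>lborel) \<partial>lborel)"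
    by (rule fubini[OF f])
  also have "\<dots> = \<bar>s\<bar> * (\<integral>t. (\<integral>x. f (x, q + s * t) \<partial>lborel) \<partial>lborel)"
    using lborel_integral_real_affine[OF s, of "\<lambda>t. \<integral>x. f (x, t) \<partial>lborel" q] by simp
  also have "(\<lambda>t. \<integral>x. f (x, q + s * t) \<partial>lborel) =
      (\<lambda>t. \<bar>s\<bar> * (\<integral>x. f (galilei s k p q (x, t)) \<partial>lborel))"
  proof
    fix t
    show "(\<integral>x. f (x, q + s * t) \<partial>lborel) = \<bar>s\<bar> * (\<integral>x. f (galilei s k p q (x, t)) \<partial>lborel)"
      using lborel_integral_real_affine[OF s, of "\<lambda>x. f (x, q + s * t)" "s * k * t + p"]
      by (simp add: galilei_def algebra_simps)
  qed
  finally show ?thesis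
    by (simp add: fubini[OF fg] power2_eq_square mult.assoc[symmetric])
qed

lemma set_integral_galilei:
  fixes f h :: "real \<times> real \<Rightarrow> real"
  assumes s: "s \<noteq> 0" and f: "set_integrable lborel (galilei s k p q ` \<Omega>) f"
    and h: "set_integrable lborel \<Omega> h" and eq: "\<And>y. y \<in> \<Omega> \<Longrightarrow> f (galilei s k p q y) = h y"
  shows "(LINT z:galilei s k p q ` \<Omega>|lborel. f z) = s\<^sup>2 * (LINT y:\<Omega>|lborel. h y)"
proof -
  let ?f = "\<lambda>z. indicator (galilei s k p q ` \<Omega>) z *\<^sub>R f z"
  have *: "?f (galilei s k p q y) = indicator \<Omega> y *\<^sub>R h y" for y
    using inj_image_mem_iff[OF inj_galilei[OF s]] eq by (simp add: indicator_def)
  show ?thesis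
    using integral_galilei[OF s, of ?f k p q] f h
    unfolding set_integrable_def set_lebesgue_integral_def * by simp
qed

lemma
  assumes s: "s \<noteq> 0" and \<Omega>: "open \<Omega>"
  shows test_functions_galilei: "\<phi> \<in> test_functions (galilei s k p q ` \<Omega>) \<Longrightarrow>
      (\<lambda>y. \<phi> (galilei s k p q y)) \<in> test_functions \<Omega>"
    and bounded_in_Cc1_galilei: "B \<subseteq> test_functions (galilei s k p q ` \<Omega>) \<Longrightarrow>
      bounded_in_Cc1 (galilei s k p q ` \<Omega>) B \<Longrightarrow>
      bounded_in_Cc1 \<Omega> ((\<lambda>\<phi> y. \<phi> (galilei s k p q y)) ` B)"
proof -
  let ?g = "galilei s k p q" and ?T = "galilei s k p q ` \<Omega>"
  \<comment> \<open>The image of the compact \<open>K\<close> is closed, so it contains the closure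
    too. Allowing any \<open>K\<close> around the support yields both the single support and the
    common compact set for \<open>B\<close>.\<close>
  have supp: "closure {y. \<phi> (?g y) \<noteq> 0} \<subseteq> galilei_inv s k p q ` K"
    if "closure {z. \<phi> z \<noteq> 0} \<subseteq> K" "compact K" for \<phi> :: "real \<times> real \<Rightarrow> real" and K
  proof (rule closure_minimal)
    show "{y. \<phi> (?g y) \<noteq> 0} \<subseteq> galilei_inv s k p q ` K"
    proof
      fix y assume "y \<in> {y. \<phi> (?g y) \<noteq> 0}"
      then have "?g y \<in> K" using that(1) closure_subset[of "{z. \<phi> z \<noteq> 0}"] by auto
      then show "y \<in> galilei_inv s k p q ` K"
        by (metis galilei_left_inverse[OF s] imageI)
    qed
  qed (intro compact_imp_closed compact_galilei_image that)
  have sub: "galilei_inv s k p q ` K \<subseteq> \<Omega>" if "K \<subseteq> ?T" for K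
    using that by (auto simp: galilei_left_inverse[OF s])
  show "(\<lambda>y. \<phi> (?g y)) \<in> test_functions \<Omega>" if \<phi>: "\<phi> \<in> test_functions ?T" for \<phi>
  proof -
    let ?K = "closure {z. \<phi> z \<noteq> 0}"
    have K: "smooth_on UNIV \<phi>" "compact ?K" "?K \<subseteq> ?T" using \<phi> by (auto simp: test_functions_def)
    have "closure {y. \<phi> (?g y) \<noteq> 0} \<subseteq> galilei_inv s k p q ` ?K" using supp[OF order_refl K(2)] .
    moreover from this have "compact (closure {y. \<phi> (?g y) \<noteq> 0})"
      using bounded_subset[OF compact_imp_bounded[OF compact_galilei_image[OF K(2)]]]
        order_trans[OF closure_subset] unfolding compact_closure by blast
    ultimately show ?thesis
      using sub[OF K(3)] smooth_on_galilei[OF K(1), of UNIV] by (auto simp: test_functions_def)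
  qed
  show "bounded_in_Cc1 \<Omega> ((\<lambda>\<phi> y. \<phi> (?g y)) ` B)"
    if B: "B \<subseteq> test_functions ?T" "bounded_in_Cc1 ?T B"
    unfolding bounded_in_Cc1_def
  proof
    obtain K where K: "compact K" "K \<subseteq> ?T" "\<forall>\<phi>\<in>B. closure {z. \<phi> z \<noteq> 0} \<subseteq> K"
      using B(2) by (auto simp: bounded_in_Cc1_def)
    show "\<exists>K. compact K \<and> K \<subseteq> \<Omega> \<and> (\<forall>\<phi>\<in>(\<lambda>\<phi> y. \<phi> (?g y)) ` B. closure {z. \<phi> z \<noteq> 0} \<subseteq> K)"
      using supp[OF _ K(1)] K(3) sub[OF K(2)] compact_galilei_image[OF K(1)]
      by (intro exI[of _ "galilei_inv s k p q ` K"]) auto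
    obtain C where C: "\<forall>\<phi>\<in>B. \<forall>z. \<bar>\<phi> z\<bar> \<le> C \<and> \<bar>dx \<phi> z\<bar> \<le> C \<and> \<bar>dt \<phi> z\<bar> \<le> C"
      using B(2) by (auto simp: bounded_in_Cc1_def)
    \<comment> \<open>The function is bounded by \<open>C\<close>, its \<open>x\<close>-derivative
      by \<open>\<bar>s\<bar> * C\<close>, its \<open>t\<close>-derivative by the last two terms;
      the sum serves for all three.\<close>
    let ?C = "C + \<bar>s * k\<bar> * C + \<bar>s\<bar> * C"
    have "\<bar>\<phi> (?g z)\<bar> \<le> ?C \<and> \<bar>dx (\<lambda>y. \<phi> (?g y)) z\<bar> \<le> ?C \<and> \<bar>dt (\<lambda>y. \<phi> (?g y)) z\<bar> \<le> ?C"
      if "\<phi> \<in> B" for \<phi> z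
    proof -
      have "smooth_on UNIV \<phi>" using that B(1) by (auto simp: test_functions_def)
      then have d: "\<phi> differentiable (at (?g z))" by (rule smooth_on_differentiable) auto
      have b: "\<bar>\<phi> (?g z)\<bar> \<le> C" "\<bar>dx \<phi> (?g z)\<bar> \<le> C" "\<bar>dt \<phi> (?g z)\<bar> \<le> C"
        using C[rule_format, OF that, of "?g z"] by simp_all
      have "dx (\<lambda>y. \<phi> (?g y)) z = s * dx \<phi> (?g z)"
        "dt (\<lambda>y. \<phi> (?g y)) z = s * k * dx \<phi> (?g z) + s * dt \<phi> (?g z)"
        by (simp_all add: pderiv_dir_galilei[OF d]) (simp_all add: galilei_def)
      moreover have "\<bar>s * dx \<phi> (?g z)\<bar> \<le> \<bar>s\<bar> * C" "\<bar>s * dt \<phi> (?g z)\<bar> \<le> \<bar>s\<bar> * C"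
        "\<bar>s * k * dx \<phi> (?g z)\<bar> \<le> \<bar>s * k\<bar> * C"
        using b by (simp_all add: abs_mult mult_left_mono)
      moreover have "C \<ge> 0" using b(1) by linarith
      then have "\<bar>s * k\<bar> * C \<ge> 0" "\<bar>s\<bar> * C \<ge> 0" by simp_all
      ultimately show ?thesis using b(1) \<open>C \<ge> 0\<close> by (intro conjI; linarith)
    qed
    then show "\<exists>C. \<forall>\<phi>\<in>(\<lambda>\<phi> y. \<phi> (?g y)) ` B. \<forall>z. \<bar>\<phi> z\<bar> \<le> C \<and> \<bar>dx \<phi> z\<bar> \<le> C \<and> \<bar>dt \<phi> z\<bar> \<le> C"
      by (intro exI[of _ ?C]) blast
  qed
qed

text \<open>This trades the supremum in \<open>ennreal\<close> for a real estimate uniform over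
  \<open>B\<close>, in which linear combinations of integrals are easy to bound. It also covers
  empty \<open>B\<close>.\<close>

lemma SUP_tendsto_zero_iff:
  fixes I :: "'a \<Rightarrow> 'b \<Rightarrow> real"
  shows "((\<lambda>\<epsilon>. SUP \<phi>\<in>B. ennreal \<bar>I \<epsilon> \<phi>\<bar>) \<longlongrightarrow> 0) F \<longleftrightarrow>
    (\<forall>e>0. \<forall>\<^sub>F \<epsilon> in F. \<forall>\<phi>\<in>B. \<bar>I \<epsilon> \<phi>\<bar> \<le> e)"
proof (intro iffI allI impI)
  fix e :: real
  assume lim: "((\<lambda>\<epsilon>. SUP \<phi>\<in>B. ennreal \<bar>I \<epsilon> \<phi>\<bar>) \<longlongrightarrow> 0) F" and "e > 0"
  then have "\<forall>\<^sub>F \<epsilon> in F. (SUP \<phi>\<in>B. ennreal \<bar>I \<epsilon> \<phi>\<bar>) < ennreal e"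
    by (intro order_tendstoD(2)) auto
  then show "\<forall>\<^sub>F \<epsilon> in F. \<forall>\<phi>\<in>B. \<bar>I \<epsilon> \<phi>\<bar> \<le> e"
  proof eventually_elim
    case (elim \<epsilon>)
    have "ennreal \<bar>I \<epsilon> \<phi>\<bar> \<le> ennreal e" if "\<phi> \<in> B" for \<phi>
      using SUP_upper[OF that, of "\<lambda>\<phi>. ennreal \<bar>I \<epsilon> \<phi>\<bar>"] elim by order
    then show ?case using \<open>e > 0\<close> by (simp add: ennreal_le_iff)
  qed
next
  assume *: "\<forall>e>0. \<forall>\<^sub>F \<epsilon> in F. \<forall>\<phi>\<in>B. \<bar>I \<epsilon> \<phi>\<bar> \<le> e"
  show "((\<lambda>\<epsilon>. SUP \<phi>\<in>B. ennreal \<bar>I \<epsilon> \<phi>\<bar>) \<longlongrightarrow> 0) F"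
  proof (rule tendsto_zero_ennreal)
    fix r :: real assume "r > 0"
    \<comment> \<open>Halving keeps the inequality strict after passing to the supremum.\<close>
    with * have "\<forall>\<^sub>F \<epsilon> in F. \<forall>\<phi>\<in>B. \<bar>I \<epsilon> \<phi>\<bar> \<le> r / 2" by (meson half_gt_zero)
    then show "\<forall>\<^sub>F \<epsilon> in F. (SUP \<phi>\<in>B. ennreal \<bar>I \<epsilon> \<phi>\<bar>) < ennreal r"
    proof eventually_elim
      case (elim \<epsilon>)
      then have "(SUP \<phi>\<in>B. ennreal \<bar>I \<epsilon> \<phi>\<bar>) \<le> ennreal (r / 2)"
        by (intro SUP_least ennreal_leI) auto
      also have "\<dots> < ennreal r" using \<open>r > 0\<close> by (intro ennreal_lessI) auto
      finally show ?case .
    qed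
  qed
qed

text \<open>The Jacobian \<open>s\<^sup>2\<close> meets the factor \<open>1 / s\<close> from
  \<open>Delta_galilei\<close>, which leaves \<open>s\<close> with its sign. Smoothness of
  \<open>U\<close> and \<open>V\<close> is assumed so that the integrals on the image side
  exist.\<close>

lemma weak_Delta_galilei:
  assumes s: "s \<noteq> 0" and \<Omega>: "open \<Omega>" and u: "smooth_on \<Omega> u" and v: "smooth_on \<Omega> v"
    and U: "smooth_on (galilei s k p q ` \<Omega>) U" "\<And>z. z \<in> galilei s k p q ` \<Omega> \<Longrightarrow> U z = u (galilei_inv s k p q z) + k"
    and V: "smooth_on (galilei s k p q ` \<Omega>) V" "\<And>z. z \<in> galilei s k p q ` \<Omega> \<Longrightarrow>
      V z = v (galilei_inv s k p q z) + k * u (galilei_inv s k p q z) + d"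
    and \<phi>: "\<phi> \<in> test_functions (galilei s k p q ` \<Omega>)"
  defines "\<psi> \<equiv> \<lambda>y. \<phi> (galilei s k p q y)"
  shows "(LINT z:galilei s k p q ` \<Omega>|lborel. Delta1 U V z * \<phi> z) =
      s * (LINT y:\<Omega>|lborel. Delta1 u v y * \<psi> y)"
    and "(LINT z:galilei s k p q ` \<Omega>|lborel. Delta2 U V z * \<phi> z) =
      s * (LINT y:\<Omega>|lborel. Delta2 u v y * \<psi> y) + s * k * (LINT y:\<Omega>|lborel. Delta1 u v y * \<psi> y)"
proof -
  let ?T = "galilei s k p q ` \<Omega>"
  have T: "open ?T" using open_galilei_image[OF s \<Omega>] .
  have \<psi>: "\<psi> \<in> test_functions \<Omega>"
    unfolding \<psi>_def by (rule test_functions_galilei[OF s \<Omega> \<phi>])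
  have int: "set_integrable lborel \<Omega> (\<lambda>y. Delta1 u v y * \<psi> y)"
    "set_integrable lborel \<Omega> (\<lambda>y. Delta2 u v y * \<psi> y)"
    "set_integrable lborel ?T (\<lambda>y. Delta1 U V y * \<phi> y)"
    "set_integrable lborel ?T (\<lambda>y. Delta2 U V y * \<phi> y)"
    using smooth_on_Delta[OF u v \<Omega>] smooth_on_Delta[OF U(1) V(1) T] \<phi> \<psi>
    by (auto intro!: integrable_test_function smooth_on_continuous)
  note D = Delta_galilei[OF s \<Omega> u v U(2) V(2)]
  have "(LINT z:?T|lborel. Delta1 U V z * \<phi> z) =
      s\<^sup>2 * (LINT y:\<Omega>|lborel. (1 / s) * (Delta1 u v y * \<psi> y))"
    using int D by (intro set_integral_galilei[OF s]) (auto simp: \<psi>_def)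
  then show "(LINT z:?T|lborel. Delta1 U V z * \<phi> z) = s * (LINT y:\<Omega>|lborel. Delta1 u v y * \<psi> y)"
    using s by (simp only: set_integral_mult_right) (simp add: power2_eq_square)
  have "(LINT z:?T|lborel. Delta2 U V z * \<phi> z) =
      s\<^sup>2 * (LINT y:\<Omega>|lborel. (1 / s) * (Delta2 u v y * \<psi> y) + (k / s) * (Delta1 u v y * \<psi> y))"
    using int D(2) by (intro set_integral_galilei[OF s] set_integral_add set_integrable_mult_right)
      (simp_all add: \<psi>_def add_divide_distrib distrib_right)
  also have "(LINT y:\<Omega>|lborel. (1 / s) * (Delta2 u v y * \<psi> y) + (k / s) * (Delta1 u v y * \<psi> y)) =
      (1 / s) * (LINT y:\<Omega>|lborel. Delta2 u v y * \<psi> y) + (k / s) * (LINT y:\<Omega>|lborel. Delta1 u v y * \<psi> y)"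
    using int by (simp only: set_integral_add set_integral_mult_right set_integrable_mult_right)
  also have "s\<^sup>2 * \<dots> =
      s * (LINT y:\<Omega>|lborel. Delta2 u v y * \<psi> y) + s * k * (LINT y:\<Omega>|lborel. Delta1 u v y * \<psi> y)"
  proof -
    have "s\<^sup>2 * ((1 / s) * X + (k / s) * Y) = s * X + s * k * Y" for X Y
      using s by (simp add: power2_eq_square field_simps)
    then show ?thesis .
  qed
  finally show "(LINT z:?T|lborel. Delta2 U V z * \<phi> z) =
      s * (LINT y:\<Omega>|lborel. Delta2 u v y * \<psi> y) + s * k * (LINT y:\<Omega>|lborel. Delta1 u v y * \<psi> y)" .
qed

section \<open>Transfer of strongly associated solutions\<close>

lemma AS1_solution_iff:
  "AS1_solution \<Omega> F \<longleftrightarrow> open \<Omega> \<and> F \<in> colombeau \<Omega> \<times> colombeau \<Omega> \<and>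
     (\<exists>u\<in>fst F. \<exists>v\<in>snd F. \<forall>B. B \<subseteq> test_functions \<Omega> \<and> bounded_in_Cc1 \<Omega> B \<longrightarrow>
        (\<forall>\<Delta>\<in>{Delta1, Delta2}. \<forall>e>0. \<forall>\<^sub>F \<epsilon> in at_right 0. \<forall>\<phi>\<in>B.
          \<bar>LINT z:\<Omega>|lborel. \<Delta> (u \<epsilon>) (v \<epsilon>) z * \<phi> z\<bar> \<le> e))"
  unfolding AS1_solution_def SUP_tendsto_zero_iff ..

lemma AS1_solution_galilei:
  assumes s: "s \<noteq> 0" and F: "AS1_solution \<Omega> F"
  shows "AS1_solution (galilei s k p q ` \<Omega>) (act_gen (galilei_transf s k p q d) \<Omega> F)"
proof -
  let ?T = "galilei s k p q ` \<Omega>" and ?G = "galilei_transf s k p q d"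
  have \<Omega>: "open \<Omega>" and FC: "F \<in> colombeau \<Omega> \<times> colombeau \<Omega>" using F by (auto simp: AS1_solution_def)
  have T: "open ?T" using open_galilei_image[OF s \<Omega>] .
  obtain u v where u: "u \<in> fst F" and v: "v \<in> snd F" and
    sol: "\<forall>B. B \<subseteq> test_functions \<Omega> \<and> bounded_in_Cc1 \<Omega> B \<longrightarrow>
      (\<forall>\<Delta>\<in>{Delta1, Delta2}. \<forall>e>0. \<forall>\<^sub>F \<epsilon> in at_right 0. \<forall>\<phi>\<in>B.
        \<bar>LINT z:\<Omega>|lborel. \<Delta> (u \<epsilon>) (v \<epsilon>) z * \<phi> z\<bar> \<le> e)"
    using F unfolding AS1_solution_iff by - (elim conjE bexE, rule that)
  let ?U = "act_net1 ?G \<Omega> u v" and ?V = "act_net2 ?G \<Omega> u v"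
  have mod: "u \<in> moderate_nets \<Omega>" "v \<in> moderate_nets \<Omega>"
    using FC u v in_quotient_imp_subset[OF equiv_colombeau_rel[OF \<Omega>]]
    by (auto simp: colombeau_def mem_Times_iff)
  have modT: "?U \<in> moderate_nets ?T" "?V \<in> moderate_nets ?T"
    using moderate_act_net1[OF s \<Omega> mod] moderate_act_net2[OF s \<Omega> mod] by auto
  have cl: "act_gen ?G \<Omega> F = (colombeau_rel ?T `` {?U}, colombeau_rel ?T `` {?V})"
    using act_gen_class[OF act_gen_defined_galilei[OF s \<Omega> FC] _ u v] T by simp
  have limits: "(\<forall>e>0. \<forall>\<^sub>F \<epsilon> in at_right 0. \<forall>\<phi>\<in>B. \<bar>LINT z:?T|lborel. \<Delta> (?U \<epsilon>) (?V \<epsilon>) z * \<phi> z\<bar> \<le> e)"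
    if B: "B \<subseteq> test_functions ?T" "bounded_in_Cc1 ?T B" and \<Delta>: "\<Delta> \<in> {Delta1, Delta2}" for B \<Delta>
  proof (intro allI impI)
    fix e :: real assume "e > 0"
    let ?B = "(\<lambda>\<phi> y. \<phi> (galilei s k p q y)) ` B"
    \<comment> \<open>The sum of the absolute coefficients \<open>\<bar>s\<bar>\<close> and
      \<open>\<bar>s\<bar> * \<bar>k\<bar>\<close> in the weak form of \<open>Delta2\<close>:
      integrals of size at most \<open>e / c\<close> over \<open>\<Omega>\<close> give at most
      \<open>e\<close> over the image.\<close>
    define c where "c = \<bar>s\<bar> * (1 + \<bar>k\<bar>)"
    have "c > 0" using s by (simp add: c_def add_pos_nonneg)
    have "?B \<subseteq> test_functions \<Omega>" "bounded_in_Cc1 \<Omega> ?B"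
      using B test_functions_galilei[OF s \<Omega>] bounded_in_Cc1_galilei[OF s \<Omega>] by auto
    then have *: "\<forall>\<Delta>\<in>{Delta1, Delta2}. \<forall>e>0. \<forall>\<^sub>F \<epsilon> in at_right 0. \<forall>\<psi>\<in>?B.
        \<bar>LINT z:\<Omega>|lborel. \<Delta> (u \<epsilon>) (v \<epsilon>) z * \<psi> z\<bar> \<le> e"
      by (intro sol[THEN spec, THEN mp] conjI)
    have "\<forall>\<^sub>F \<epsilon> in at_right 0. \<forall>\<psi>\<in>?B. \<bar>LINT z:\<Omega>|lborel. Delta1 (u \<epsilon>) (v \<epsilon>) z * \<psi> z\<bar> \<le> e / c"
      "\<forall>\<^sub>F \<epsilon> in at_right 0. \<forall>\<psi>\<in>?B. \<bar>LINT z:\<Omega>|lborel. Delta2 (u \<epsilon>) (v \<epsilon>) z * \<psi> z\<bar> \<le> e / c"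
      by (rule *[THEN bspec, THEN spec, THEN mp, OF _ divide_pos_pos[OF \<open>e > 0\<close> \<open>c > 0\<close>]]; simp)+
    with eventually_unit_interval
    show "\<forall>\<^sub>F \<epsilon> in at_right 0. \<forall>\<phi>\<in>B. \<bar>LINT z:?T|lborel. \<Delta> (?U \<epsilon>) (?V \<epsilon>) z * \<phi> z\<bar> \<le> e"
    proof eventually_elim
      case (elim \<epsilon>)
      show ?case
      proof
        fix \<phi> assume \<phi>: "\<phi> \<in> B"
        let ?I = "\<lambda>D. LINT y:\<Omega>|lborel. D (u \<epsilon>) (v \<epsilon>) y * \<phi> (galilei s k p q y)"
        have smooth: "smooth_on \<Omega> (u \<epsilon>)" "smooth_on \<Omega> (v \<epsilon>)" "smooth_on ?T (?U \<epsilon>)" "smooth_on ?T (?V \<epsilon>)"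
          using mod modT elim(1) by (auto simp: moderate_nets_def)
        have \<phi>T: "\<phi> \<in> test_functions ?T" using B(1) \<phi> by auto
        have weak: "(LINT z:?T|lborel. Delta1 (?U \<epsilon>) (?V \<epsilon>) z * \<phi> z) = s * ?I Delta1"
          "(LINT z:?T|lborel. Delta2 (?U \<epsilon>) (?V \<epsilon>) z * \<phi> z) = s * ?I Delta2 + s * k * ?I Delta1"
          by (rule weak_Delta_galilei[OF s \<Omega> smooth(1,2,3) _ smooth(4) _ \<phi>T];
              rule act_net1_galilei[OF s] act_net2_galilei[OF s]; assumption)+
        have "\<bar>?I Delta1\<bar> \<le> e / c" "\<bar>?I Delta2\<bar> \<le> e / c" using elim \<phi> by auto
        then have le: "\<bar>s * ?I Delta1\<bar> \<le> \<bar>s\<bar> * (e / c)" "\<bar>s * ?I Delta2\<bar> \<le> \<bar>s\<bar> * (e / c)"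
          "\<bar>s * k * ?I Delta1\<bar> \<le> \<bar>s\<bar> * \<bar>k\<bar> * (e / c)"
          by (simp_all only: abs_mult mult_left_mono abs_ge_zero mult_nonneg_nonneg)
        have "\<bar>s\<bar> * y + \<bar>s\<bar> * \<bar>k\<bar> * y = c * y" for y
          by (simp add: c_def algebra_simps)
        from this[of "e / c"] have sum: "\<bar>s\<bar> * (e / c) + \<bar>s\<bar> * \<bar>k\<bar> * (e / c) = e"
          using \<open>c > 0\<close> by (simp del: times_divide_eq_right) simp
        have nonneg: "\<bar>s\<bar> * \<bar>k\<bar> * (e / c) \<ge> 0" using \<open>c > 0\<close> \<open>e > 0\<close> by simp
        have "\<bar>LINT z:?T|lborel. Delta1 (?U \<epsilon>) (?V \<epsilon>) z * \<phi> z\<bar> \<le> e"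
          unfolding weak using le(1) sum nonneg by linarith
        moreover have "\<bar>LINT z:?T|lborel. Delta2 (?U \<epsilon>) (?V \<epsilon>) z * \<phi> z\<bar> \<le> e"
          unfolding weak using le(2,3) sum by linarith
        ultimately show "\<bar>LINT z:?T|lborel. \<Delta> (?U \<epsilon>) (?V \<epsilon>) z * \<phi> z\<bar> \<le> e"
          using \<Delta> by auto
      qed
    qed
  qed
  have "act_gen ?G \<Omega> F \<in> colombeau ?T \<times> colombeau ?T"
    using modT by (simp add: cl colombeau_def quotientI)
  moreover have mem: "?U \<in> fst (act_gen ?G \<Omega> F)" "?V \<in> snd (act_gen ?G \<Omega> F)"
    using modT equiv_class_self[OF equiv_colombeau_rel[OF T]] by (simp_all add: cl)
  ultimately show ?thesis
    unfolding AS1_solution_iff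
    by (intro conjI T bexI[OF _ mem(1)] bexI[OF _ mem(2)] allI impI ballI limits) auto
qed

section \<open>The five groups\<close>

lemma galilei_transf_eq:
  "G1 = (\<lambda>\<eta>. galilei_transf (exp \<eta>) 0 0 0 0)"
  "G2 = (\<lambda>\<eta>. galilei_transf 1 0 0 \<eta> 0)"
  "G3 = (\<lambda>\<eta>. galilei_transf 1 \<eta> 0 0 (\<eta>\<^sup>2 / 2))"
  "G4 = (\<lambda>\<eta>. galilei_transf 1 0 \<eta> 0 0)"
  "G5 = (\<lambda>\<eta>. galilei_transf 1 0 0 0 \<eta>)"
  by (auto simp: fun_eq_iff galilei_transf_def galilei_def G1_def G2_def G3_def G4_def G5_def)

text \<open>Smoothness is joint in \<open>\<eta>\<close> and the point, where products such as
  \<open>\<eta> * t\<close> and \<open>\<eta> * u\<close> occur, so it does not follow from the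
  affine form of each single transformation.\<close>

lemma one_parameter_groups:
  assumes "G \<in> {G1, G2, G3, G4, G5}"
  shows "one_parameter_group G"
proof -
  \<comment> \<open>Pattern matching is replaced by projections, so that each map is built from
    linear maps, pairs, sums, products, powers and \<open>exp\<close>; halving is written as
    multiplication by \<open>1 / 2\<close> for the same reason.\<close>
  have *: "(\<lambda>(\<eta>, p). G1 \<eta> p) = (\<lambda>w. ((exp (fst w) * fst (fst (snd w)), exp (fst w) * snd (fst (snd w))), snd (snd w)))"
    "(\<lambda>(\<eta>, p). G2 \<eta> p) = (\<lambda>w. ((fst (fst (snd w)), snd (fst (snd w)) + fst w), snd (snd w)))"
    "(\<lambda>(\<eta>, p). G3 \<eta> p) = (\<lambda>w. ((fst (fst (snd w)) + fst w * snd (fst (snd w)), snd (fst (snd w))),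
        (fst (snd (snd w)) + fst w, snd (snd (snd w)) + fst w * fst (snd (snd w)) + (1 / 2) * (fst w)\<^sup>2)))"
    "(\<lambda>(\<eta>, p). G4 \<eta> p) = (\<lambda>w. ((fst (fst (snd w)) + fst w, snd (fst (snd w))), snd (snd w)))"
    "(\<lambda>(\<eta>, p). G5 \<eta> p) = (\<lambda>w. (fst (snd w), (fst (snd (snd w)), snd (snd (snd w)) + fst w)))"
    by (auto simp: fun_eq_iff G1_def G2_def G3_def G4_def G5_def)
  note linear = bounded_linear_fst_comp bounded_linear_snd_comp bounded_linear_ident
  have "smooth_on UNIV (\<lambda>(\<eta>, p). G \<eta> p)"
    using assms
    by (elim insertE emptyE; simp only: *;
        intro smooth_on_Pair smooth_on_add smooth_on_mult smooth_on_power smooth_on_const smooth_on_exp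
          open_UNIV; (intro smooth_on_bounded_linear linear open_UNIV)?)
  moreover have "G 0 = id \<and> (\<forall>\<eta> \<theta>. G (\<eta> + \<theta>) = G \<eta> \<circ> G \<theta>)"
    using assms
    by (auto simp: fun_eq_iff G1_def G2_def G3_def G4_def G5_def exp_add power2_eq_square field_simps)
  ultimately show ?thesis by (simp add: one_parameter_group_def)
qed

theorem theorem2p2:
  fixes G :: "real \<Rightarrow> transf"
  assumes "G \<in> {G1, G2, G3, G4, G5}"
  shows "AS1_symmetry_group G \<and>
    (\<forall>\<eta> \<Omega> F. AS1_solution \<Omega> F \<longrightarrow>
       act_gen_defined (G \<eta>) \<Omega> F \<and>
       AS1_solution (base_map (G \<eta>) ` \<Omega>) (act_gen (G \<eta>) \<Omega> F))"
proof -
  \<comment> \<open>The parameters may depend on \<open>\<eta>\<close>: the transfer of solutions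
    concerns one transformation at a time, and the group law is settled separately.\<close>
  have *: "\<exists>s k p q d. s \<noteq> 0 \<and> G \<eta> = galilei_transf s k p q d" for \<eta>
    using assms unfolding galilei_transf_eq
    by (elim insertE emptyE; simp) (metis exp_not_eq_zero one_neq_zero)+
  have proj: "projectable (G \<eta>)" for \<eta>
    using *[of \<eta>] projectable_galilei by force
  have classical: "classical_solution (base_map (G \<eta>) ` \<Omega>) (act_fun (G \<eta>) \<Omega> f)"
    if "classical_solution \<Omega> f" for \<eta> \<Omega> f
    using *[of \<eta>] classical_solution_galilei[OF _ that] by force
  have AS1: "act_gen_defined (G \<eta>) \<Omega> F" "AS1_solution (base_map (G \<eta>) ` \<Omega>) (act_gen (G \<eta>) \<Omega> F)"
    if "AS1_solution \<Omega> F" for \<eta> \<Omega> F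
    using *[of \<eta>] act_gen_defined_galilei[of _ \<Omega> F] AS1_solution_galilei[OF _ that] that
    by (force simp: AS1_solution_def)+
  show ?thesis
    using one_parameter_groups[OF assms] proj classical AS1
    by (auto simp: AS1_symmetry_group_def symmetry_group_def)
qed

end
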